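(* Let $H$ and $U$ be Hilbert spaces, let $A:D(A)\subset H\to H$ be a densely defined closed operator such that $A$ and $A^\star$ are dissipative, and let $B\in\mathcal{L}(U,H)$ be such that the restriction of $BB^\star$ to $D(A)$ is a bounded operator in $D(A)$. Let $d:\mathbb{R}_+\to\mathbb{R}$ be essentially bounded, and suppose that there exist positive constants $d_0$ and $d_1$ such that, for a.e. $t\ge 0$, $$d_0\le d(t)\le d_1.$$ Assume that the origin of the system $$\frac{d}{dt}v=(A-d_0BB^\star)v,\qquad v(0)=v_0,$$ is globally exponentially stable in $H$. Then, for any initial condition $v_0\in H$ initialized at $\tau=0$, the trajectory of $$\frac{d}{dt}v=(A-d(t)BB^\star)v,\qquad v(0)=v_0,$$ converges exponentially to $0$ in $H$, i.e., there exist $K,\beta>0$ such that $\|v(t)\|_H\le Ke^{-\beta t}\|v_0\|_H$ for all $t\ge 0$.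
   Context: $B^\star$ and $A^\star$ denote adjoint operators, and $D(A)$ is endowed with the graph norm $\|v\|_H+\|Av\|_H$. Under the assumptions, $A$ generates a strongly continuous semigroup of contractions $(e^{tA})_{t\ge 0}$ on $H$. For $v_0\in H$, the trajectory of the time-varying system is its mild solution, i.e., the unique $v\in C([0,\infty);H)$ satisfying $$v(t)=e^{tA}v_0-\int_0^t e^{(t-s)A}d(s)BB^\star v(s)\,ds,\quad t\ge 0.$$ The origin of $\frac{d}{dt}v=(A-d_0BB^\star)v$ is globally exponentially stable in $H$ if there exist constants $C_0,\alpha>0$ such that every (mild) solution satisfies $\|v(t)\|_H\le C_0e^{-\alpha t}\|v_0\|_H$ for all $t\ge 0$ and all $v_0\in H$. *)

theory Defs
  imports "HOL-Analysis.Analysis"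
begin

text \<open>
  Hilbert spaces are types of sort \<open>{real_inner, banach}\<close>; no separability is assumed. A complex
  Hilbert space is covered by taking the real part of its inner product: dissipativity, adjoints,
  semigroups and generators are then unchanged.

  An unbounded operator is a pair of its domain \<open>D\<close> and a function \<open>A\<close>; the values of \<open>A\<close> outside
  of \<open>D\<close> are irrelevant.
\<close>

definition linear_operator_on :: "'a::real_vector set \<Rightarrow> ('a \<Rightarrow> 'a) \<Rightarrow> bool" where
  "linear_operator_on D A \<longleftrightarrow> subspace D \<and>
     (\<forall>x\<in>D. \<forall>y\<in>D. A (x + y) = A x + A y) \<and> (\<forall>c. \<forall>x\<in>D. A (c *\<^sub>R x) = c *\<^sub>R A x)"

definition densely_defined :: "'a::topological_space set \<Rightarrow> bool" where
  "densely_defined D \<longleftrightarrow> closure D = UNIV"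

definition closed_operator :: "'a::topological_space set \<Rightarrow> ('a \<Rightarrow> 'a) \<Rightarrow> bool" where
  "closed_operator D A \<longleftrightarrow> closed ((\<lambda>x. (x, A x)) ` D)"

definition dissipative :: "'a::real_inner set \<Rightarrow> ('a \<Rightarrow> 'a) \<Rightarrow> bool" where
  "dissipative D A \<longleftrightarrow> (\<forall>x\<in>D. A x \<bullet> x \<le> 0)"

definition adjoint_domain :: "'a::real_inner set \<Rightarrow> ('a \<Rightarrow> 'a) \<Rightarrow> 'a set" where
  "adjoint_domain D A = {y. \<exists>z. \<forall>x\<in>D. A x \<bullet> y = x \<bullet> z}"

text \<open>The vector described here is unique for \<open>y\<close> in the adjoint domain when \<open>D\<close> is dense.\<close>

definition adjoint_op :: "'a::real_inner set \<Rightarrow> ('a \<Rightarrow> 'a) \<Rightarrow> 'a \<Rightarrow> 'a" where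
  "adjoint_op D A y = (THE z. \<forall>x\<in>D. A x \<bullet> y = x \<bullet> z)"

definition graph_norm :: "('a::real_normed_vector \<Rightarrow> 'a) \<Rightarrow> 'a \<Rightarrow> real" where
  "graph_norm A x = norm x + norm (A x)"

definition restricts_to_bounded_on_domain ::
    "'a::real_normed_vector set \<Rightarrow> ('a \<Rightarrow> 'a) \<Rightarrow> ('a \<Rightarrow> 'a) \<Rightarrow> bool" where
  "restricts_to_bounded_on_domain D A P \<longleftrightarrow>
     (\<forall>x\<in>D. P x \<in> D) \<and> (\<exists>C. \<forall>x\<in>D. graph_norm A (P x) \<le> C * graph_norm A x)"

definition C0_semigroup :: "(real \<Rightarrow> 'a::real_normed_vector \<Rightarrow> 'a) \<Rightarrow> bool" where
  "C0_semigroup S \<longleftrightarrow>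
     (\<forall>t\<ge>0. bounded_linear (S t)) \<and> S 0 = id \<and>
     (\<forall>s\<ge>0. \<forall>t\<ge>0. S (s + t) = S s \<circ> S t) \<and>
     (\<forall>x. ((\<lambda>t. S t x) \<longlongrightarrow> x) (at_right 0))"

text \<open>Domains are compared as well: \<open>D\<close> is exactly the set where the difference quotient converges.\<close>

definition generates ::
    "'a::real_normed_vector set \<Rightarrow> ('a \<Rightarrow> 'a) \<Rightarrow> (real \<Rightarrow> 'a \<Rightarrow> 'a) \<Rightarrow> bool" where
  "generates D A S \<longleftrightarrow> C0_semigroup S \<and>
     (\<forall>x y. x \<in> D \<and> A x = y \<longleftrightarrow> ((\<lambda>t. (S t x - x) /\<^sub>R t) \<longlongrightarrow> y) (at_right 0))"

text \<open>A generator determines its semigroup at all times \<open>t \<ge> 0\<close>; the choice below only concerns the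
  values at negative times, which are never used.\<close>

definition semigroup_of ::
    "'a::real_normed_vector set \<Rightarrow> ('a \<Rightarrow> 'a) \<Rightarrow> real \<Rightarrow> 'a \<Rightarrow> 'a" where
  "semigroup_of D A = (SOME S. generates D A S)"

text \<open>Mild solution of \<open>v' = (A - d(t) B B\<^sup>*) v\<close>, \<open>v(0) = v0\<close>. The integral is the gauge integral, as
  the library's Bochner integral is restricted to separable spaces. For essentially bounded
  measurable \<open>d\<close> and continuous \<open>v\<close> the integrand is Bochner integrable and the two integrals agree.\<close>

definition mild_solution ::
    "'h::{real_inner, banach} set \<Rightarrow> ('h \<Rightarrow> 'h) \<Rightarrow> ('u::{real_inner, banach} \<Rightarrow> 'h) \<Rightarrow>
     (real \<Rightarrow> real) \<Rightarrow> 'h \<Rightarrow> (real \<Rightarrow> 'h) \<Rightarrow> bool" where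
  "mild_solution D A B d v0 v \<longleftrightarrow> continuous_on {0..} v \<and>
     (\<forall>t\<ge>0.
        (\<lambda>s. semigroup_of D A (t - s) (d s *\<^sub>R B (adjoint B (v s)))) integrable_on {0..t} \<and>
        v t = semigroup_of D A t v0 -
          integral {0..t} (\<lambda>s. semigroup_of D A (t - s) (d s *\<^sub>R B (adjoint B (v s)))))"

definition globally_exponentially_stable ::
    "'h::{real_inner, banach} set \<Rightarrow> ('h \<Rightarrow> 'h) \<Rightarrow> ('u::{real_inner, banach} \<Rightarrow> 'h) \<Rightarrow>
     (real \<Rightarrow> real) \<Rightarrow> bool" where
  "globally_exponentially_stable D A B d \<longleftrightarrow>
     (\<exists>C0>0. \<exists>\<alpha>>0. \<forall>v0 v. mild_solution D A B d v0 v \<longrightarrow>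
        (\<forall>t\<ge>0. norm (v t) \<le> C0 * exp (- \<alpha> * t) * norm v0))"

end

theory Submission
  imports Defs
begin

text \<open>
  Write \<open>S\<close> for the semigroup of \<open>A\<close>, \<open>P = B B\<^sup>*\<close> and \<open>E = \<integral>\<^sub>0\<^sup>\<tau> |B\<^sup>* v|\<^sup>2\<close>. The damping
  inequality \<open>|v(\<tau>)|\<^sup>2 \<le> |v(0)|\<^sup>2 - 2 d\<^sub>0 E\<close> shows that the norm decreases, and that it decreases by
  a fixed factor over a window of length \<open>\<tau>\<close> as soon as \<open>E\<close> is not small. If \<open>E\<close> is small, then
  \<open>v\<close> is close at time \<open>\<tau>\<close> to the trajectory \<open>w\<close> of the reference system (constant gain \<open>d\<^sub>0\<close>) with
  the same initial value: the difference \<open>z = v - w\<close> solves \<open>z' = (A - d\<^sub>0 P) z - (d - d\<^sub>0) P v\<close> with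
  \<open>z(0) = 0\<close>, and its own damping term absorbs the forcing up to a multiple of \<open>|B\<^sup>* v|\<^sup>2\<close>, so that
  \<open>|z(\<tau>)|\<^sup>2 \<le> (d\<^sub>1 - d\<^sub>0)\<^sup>2 / (2 d\<^sub>0) E\<close>. For \<open>\<tau>\<close> large, \<open>|w(\<tau>)| \<le> |v(0)| / 2\<close> by stability of the
  reference system. Combining the three estimates (\<open>contraction_over_window\<close>) gives
  \<open>|v(\<tau>)|\<^sup>2 \<le> q |v(0)|\<^sup>2\<close> with \<open>q < 1\<close> depending on \<open>d\<^sub>0\<close> and \<open>d\<^sub>1\<close> only. The bounds on \<open>d\<close> are
  invariant under time shifts, so the estimate can be iterated.

  Both estimates are instances of one energy inequality for
  \<open>u(t) = S(t) u(0) + \<integral>\<^sub>0\<^sup>t S(t - s) f(s) ds\<close> (\<open>energy_inequality\<close>), namely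
  \<open>|u(\<tau>)|\<^sup>2 \<le> |u(0)|\<^sup>2 + 2 \<integral>\<^sub>0\<^sup>\<tau> e\<close> whenever \<open>f \<bullet> u \<le> e\<close> with \<open>e\<close> continuous and \<open>f\<close> has values in a compact
  set. As \<open>f\<close> is only measurable in time and \<open>u\<close> need not lie in the domain of \<open>A\<close>, it is not
  obtained by differentiating \<open>|u|\<^sup>2\<close>, but by cutting \<open>[0, \<tau>]\<close> into short intervals: \<open>S(r)\<close>
  tends to the identity uniformly on compact sets as \<open>r \<longlonglongrightarrow> 0\<close>, so the error on an interval of length
  \<open>h\<close> is \<open>h\<close> times an arbitrarily small number.

  The semigroup is a choice among those generated by \<open>A\<close>, so two facts are needed about it.
  One exists (\<open>generates_T\<close>): it is the limit of implicit Euler approximations, the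
  resolvents \<open>(I - h A)\<^sup>-\<^sup>1\<close> being everywhere defined contractions because \<open>A\<close> and its adjoint are
  dissipative. And each semigroup generated by \<open>A\<close> is contractive (\<open>generates_imp_contraction\<close>).
  Finally, stability of the reference system is used through the existence of its trajectories
  (\<open>mild_solution_exists\<close>), a fixed point argument.
\<close>

section \<open>Orthogonality and adjoints in Hilbert spaces\<close>

text \<open>The nonzero vector is the difference between a point outside the subspace and its projection,
  which is the limit of a minimizing sequence.\<close>

lemma closed_subspace_orthogonal_nonzero:
  fixes M :: "'a::{real_inner, banach} set"
  assumes M: "subspace M" "closed M" and "x \<notin> M"
  shows "\<exists>y. y \<noteq> 0 \<and> (\<forall>m\<in>M. m \<bullet> y = 0)"
proof -
  define \<delta> where "\<delta> = infdist x M"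
  have M0: "0 \<in> M" using M(1) by (simp add: subspace_0)
  have "\<exists>m\<in>M. dist x m < \<delta> + 1 / real (Suc n)" for n
  proof -
    have "\<delta> < \<delta> + 1 / real (Suc n)" by simp
    then show ?thesis
      unfolding \<delta>_def using infdist_notempty[of M x] M0
      by (metis cInf_lessD empty_iff imageE image_is_empty)
  qed
  then obtain m where m: "\<And>n. m n \<in> M" "\<And>n. dist x (m n) < \<delta> + 1 / real (Suc n)" by metis
  have \<delta>0: "\<delta> \<ge> 0" by (simp add: \<delta>_def infdist_nonneg)
  have lb: "\<delta> \<le> norm (x - y)" if "y \<in> M" for y
    using infdist_le[OF that, of x] by (simp add: \<delta>_def dist_norm)
  \<comment> \<open>The parallelogram law, as the midpoint of two points of \<open>M\<close> has distance at least \<open>\<delta>\<close> from \<open>x\<close>.\<close>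
  have par: "(norm (m i - m j))\<^sup>2 \<le> 2 * (norm (x - m i))\<^sup>2 + 2 * (norm (x - m j))\<^sup>2 - 4 * \<delta>\<^sup>2" for i j
  proof -
    have "(1/2) *\<^sub>R (m i + m j) \<in> M" using M(1) m(1) by (simp add: subspace_add subspace_scale)
    from lb[OF this] have "\<delta>\<^sup>2 \<le> (norm (x - (1/2) *\<^sub>R (m i + m j)))\<^sup>2"
      using \<delta>0 by (intro power_mono) auto
    then show ?thesis
      by (simp add: power2_norm_eq_inner algebra_simps inner_commute)
  qed
  have lim0: "(\<lambda>n. \<delta> + 1 / real (Suc n)) \<longlonglongrightarrow> \<delta>"
    using tendsto_add[OF tendsto_const LIMSEQ_inverse_real_of_nat, of \<delta>] by (simp add: inverse_eq_divide)
  have lim1: "(\<lambda>n. norm (x - m n)) \<longlonglongrightarrow> \<delta>"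
    by (rule tendsto_sandwich[OF _ _ tendsto_const lim0])
       (use lb m less_imp_le[OF m(2)] in \<open>auto simp: dist_norm simp del: of_nat_Suc\<close>)
  have "Cauchy m"
  proof (rule metric_CauchyI)
    fix e :: real assume e: "e > 0"
    have "(\<lambda>n. (norm (x - m n))\<^sup>2) \<longlonglongrightarrow> \<delta>\<^sup>2" by (intro tendsto_intros lim1)
    then have "eventually (\<lambda>n. (norm (x - m n))\<^sup>2 < \<delta>\<^sup>2 + e\<^sup>2/4) sequentially"
      by (rule order_tendstoD) (use e in auto)
    then obtain N where N: "\<And>n. n \<ge> N \<Longrightarrow> (norm (x - m n))\<^sup>2 < \<delta>\<^sup>2 + e\<^sup>2/4"
      by (auto simp: eventually_sequentially)
    have "dist (m i) (m j) < e" if "i \<ge> N" "j \<ge> N" for i j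
    proof -
      have "(norm (m i - m j))\<^sup>2 < e\<^sup>2"
        using par[of i j] N[OF that(1)] N[OF that(2)] by linarith
      then show ?thesis using e by (simp add: dist_norm power2_less_imp_less)
    qed
    then show "\<exists>N. \<forall>i\<ge>N. \<forall>j\<ge>N. dist (m i) (m j) < e" by blast
  qed
  then obtain p where p: "m \<longlonglongrightarrow> p" using Cauchy_convergent_iff convergent_def by blast
  have pM: "p \<in> M" using M(2) m(1) p closed_sequentially by blast
  have np: "norm (x - p) = \<delta>"
    using LIMSEQ_unique[OF tendsto_norm[OF tendsto_diff[OF tendsto_const p]] lim1] .
  \<comment> \<open>Otherwise moving \<open>p\<close> along \<open>z\<close> by the optimal factor \<open>c\<close> would decrease the distance to \<open>x\<close>.\<close>
  have "z \<bullet> (x - p) = 0" if z: "z \<in> M" for z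
  proof (rule ccontr)
    assume nz: "z \<bullet> (x - p) \<noteq> 0"
    then have zz: "z \<bullet> z > 0" by auto
    define c where "c = (z \<bullet> (x - p)) / (z \<bullet> z)"
    have "p + c *\<^sub>R z \<in> M" using pM z M(1) by (simp add: subspace_add subspace_scale)
    from lb[OF this] have "\<delta>\<^sup>2 \<le> (norm ((x - p) - c *\<^sub>R z))\<^sup>2"
      using \<delta>0 by (intro power_mono) (auto simp: algebra_simps)
    also have "\<dots> = (norm (x - p))\<^sup>2 - 2 * c * (z \<bullet> (x - p)) + c\<^sup>2 * (z \<bullet> z)"
      unfolding power2_norm_eq_inner
      by (simp add: inner_diff_left inner_diff_right inner_commute power2_eq_square)
    also have "\<dots> = \<delta>\<^sup>2 - (z \<bullet> (x - p))\<^sup>2 / (z \<bullet> z)"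
      using zz by (simp add: np c_def power2_eq_square field_simps)
    finally show False using zz nz by (simp add: divide_le_0_iff)
  qed
  moreover have "x - p \<noteq> 0" using pM \<open>x \<notin> M\<close> by auto
  ultimately show ?thesis by blast
qed

lemma riesz_representation:
  fixes f :: "'a::{real_inner, banach} \<Rightarrow> real"
  assumes f: "bounded_linear f"
  shows "\<exists>z. \<forall>x. f x = x \<bullet> z"
proof (cases "\<forall>x. f x = 0")
  case True
  then show ?thesis by (intro exI[of _ 0]) auto
next
  case False
  interpret f: bounded_linear f by fact
  let ?M = "{x. f x = 0}"
  obtain x where "x \<notin> ?M" using False by auto
  moreover have "subspace ?M" by (auto simp: subspace_def f.add f.scaleR f.zero)
  moreover have "closed ?M"
    by (intro closed_Collect_eq continuous_intros) (simp add: f.continuous_on continuous_on_id)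
  ultimately obtain y where y: "y \<noteq> 0" "\<And>m. f m = 0 \<Longrightarrow> m \<bullet> y = 0"
    using closed_subspace_orthogonal_nonzero[of ?M x] by auto
  have yy: "y \<bullet> y \<noteq> 0" using y by auto
  have "f x = x \<bullet> ((f y / (y \<bullet> y)) *\<^sub>R y)" for x
  proof -
    have "f (f y *\<^sub>R x - f x *\<^sub>R y) = 0" by (simp add: f.diff f.scaleR)
    from y(2)[OF this] have "f y * (x \<bullet> y) = f x * (y \<bullet> y)" by (simp add: inner_diff_left)
    then show ?thesis using yy by (simp add: field_simps)
  qed
  then show ?thesis by blast
qed

text \<open>The library defines the adjoint by choice; in a Hilbert space the Riesz representation
  provides a function to choose.\<close>

lemma inner_adjoint:
  fixes B :: "'u::{real_inner, banach} \<Rightarrow> 'h::real_inner"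
  assumes B: "bounded_linear B"
  shows "B u \<bullet> x = u \<bullet> adjoint B x"
proof -
  have "\<exists>z. \<forall>u. B u \<bullet> x = u \<bullet> z" for x
    by (rule riesz_representation) (intro bounded_linear_compose[OF bounded_linear_inner_left B])
  then have "\<exists>g. \<forall>u x. B u \<bullet> x = u \<bullet> g x" by metis
  then have "\<forall>u x. B u \<bullet> x = u \<bullet> adjoint B x"
    unfolding adjoint_def by (rule someI_ex)
  then show ?thesis by blast
qed

lemma bounded_linear_adjoint:
  fixes B :: "'u::{real_inner, banach} \<Rightarrow> 'h::real_inner"
  assumes B: "bounded_linear B"
  shows "bounded_linear (adjoint B)"
proof -
  obtain K where K: "K > 0" "\<And>u. norm (B u) \<le> norm u * K"
    using bounded_linear.pos_bounded[OF B] by blast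
  have eq: "a = b" if "\<And>u. u \<bullet> a = u \<bullet> b" for a b :: 'u
    using that[of "a - b"] by (metis eq_iff_diff_eq_0 inner_diff_right inner_eq_zero_iff)
  show ?thesis
  proof (rule bounded_linear_intro[where K = K])
    show "adjoint B (x + y) = adjoint B x + adjoint B y" for x y
      by (rule eq) (simp add: inner_adjoint[OF B, symmetric] inner_add_right)
    show "adjoint B (r *\<^sub>R x) = r *\<^sub>R adjoint B x" for r x
      by (rule eq) (simp add: inner_adjoint[OF B, symmetric])
    show "norm (adjoint B x) \<le> norm x * K" for x
    proof -
      have "(norm (adjoint B x))\<^sup>2 = B (adjoint B x) \<bullet> x"
        by (simp add: inner_adjoint[OF B] power2_norm_eq_inner)
      also have "\<dots> \<le> norm (B (adjoint B x)) * norm x" by (rule norm_cauchy_schwarz)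
      also have "\<dots> \<le> norm (adjoint B x) * K * norm x" by (intro mult_right_mono K) auto
      finally have "norm (adjoint B x) * norm (adjoint B x) \<le> norm (adjoint B x) * (norm x * K)"
        by (simp add: power2_eq_square algebra_simps)
      then show ?thesis
        using K(1) by (cases "adjoint B x = 0") (auto simp: mult_le_cancel_left)
    qed
  qed
qed

section \<open>Resolvents of maximally dissipative operators\<close>

lemma norm_le_of_inner_nonpos:
  fixes x y :: "'a::real_inner"
  assumes "y \<bullet> x \<le> 0"
  shows "norm x \<le> norm (x - y)"
proof -
  have "norm x * norm x \<le> (x - y) \<bullet> x"
    using assms by (simp add: inner_diff_left flip: power2_norm_eq_inner power2_eq_square)
  also have "\<dots> \<le> norm (x - y) * norm x" by (rule norm_cauchy_schwarz)
  finally show ?thesis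
    by (cases "x = 0") (auto dest: mult_right_le_imp_le)
qed

text \<open>Maximally dissipative operators: dissipative, with \<open>I - h A\<close> onto for each \<open>h > 0\<close>. They are the
  generators of contraction semigroups.\<close>

locale max_dissipative =
  fixes D :: "'a::{real_inner, banach} set" and A :: "'a \<Rightarrow> 'a"
  assumes linear: "linear_operator_on D A"
    and dense: "densely_defined D"
    and dissip: "dissipative D A"
    and range: "h > 0 \<Longrightarrow> \<exists>x\<in>D. x - h *\<^sub>R A x = y"
begin

lemma sub: "subspace D"
  and A_add: "x \<in> D \<Longrightarrow> y \<in> D \<Longrightarrow> A (x + y) = A x + A y"
  and A_scaleR: "x \<in> D \<Longrightarrow> A (c *\<^sub>R x) = c *\<^sub>R A x"
  using linear by (auto simp: linear_operator_on_def)

lemma A_diff: "x \<in> D \<Longrightarrow> y \<in> D \<Longrightarrow> A (x - y) = A x - A y"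
  using A_add[of x "- y"] A_scaleR[of y "-1"] subspace_neg[OF sub, of y] by simp

lemma D_intros:
  "x \<in> D \<Longrightarrow> y \<in> D \<Longrightarrow> x + y \<in> D" "x \<in> D \<Longrightarrow> y \<in> D \<Longrightarrow> x - y \<in> D"
  "x \<in> D \<Longrightarrow> c *\<^sub>R x \<in> D"
  using sub by (auto simp: subspace_add subspace_diff subspace_scale)

lemma norm_le_resolvent_eq:
  assumes "x \<in> D" "h \<ge> 0"
  shows "norm x \<le> norm (x - h *\<^sub>R A x)"
  using assms dissip by (intro norm_le_of_inner_nonpos) (simp add: dissipative_def mult_nonneg_nonpos)

text \<open>The resolvent \<open>J h = (I - h A)\<^sup>-\<^sup>1\<close>, one step of the implicit Euler method; it is meaningful for
  \<open>h > 0\<close>.\<close>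

definition J :: "real \<Rightarrow> 'a \<Rightarrow> 'a" where
  "J h y = (SOME x. x \<in> D \<and> x - h *\<^sub>R A x = y)"

lemma J_spec:
  assumes "h > 0"
  shows "J h y \<in> D" "J h y - h *\<^sub>R A (J h y) = y"
proof -
  have "\<exists>x. x \<in> D \<and> x - h *\<^sub>R A x = y" using range[OF assms] by blast
  from someI_ex[OF this] show "J h y \<in> D" "J h y - h *\<^sub>R A (J h y) = y"
    by (auto simp: J_def)
qed

lemma scaleR_A_J: "h > 0 \<Longrightarrow> h *\<^sub>R A (J h y) = J h y - y"
  using J_spec(2)[of h y] by (metis diff_diff_eq2 add_diff_cancel_left')

lemma J_unique:
  assumes "h > 0" "x \<in> D" "x - h *\<^sub>R A x = y"
  shows "J h y = x"
proof -
  note J = J_spec[OF assms(1), of y]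
  have "norm (J h y - x) \<le> norm ((J h y - x) - h *\<^sub>R A (J h y - x))"
    using assms J by (intro norm_le_resolvent_eq D_intros) auto
  also have "(J h y - x) - h *\<^sub>R A (J h y - x) = 0"
    unfolding A_diff[OF J(1) assms(2)] scaleR_diff_right scaleR_A_J[OF assms(1)]
    by (simp add: assms(3)[symmetric])
  finally show ?thesis by simp
qed

lemma J_add: "h > 0 \<Longrightarrow> J h (x + y) = J h x + J h y"
  using J_spec[of h x] J_spec[of h y]
  by (intro J_unique D_intros) (auto simp: A_add scaleR_add_right scaleR_A_J)

lemma J_scaleR: 
  assumes "h > 0" shows "J h (c *\<^sub>R x) = c *\<^sub>R J h x"
proof (intro J_unique D_intros)
  have "h *\<^sub>R A (c *\<^sub>R J h x) = c *\<^sub>R (J h x - x)"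
    using assms by (metis A_scaleR J_spec(1) scaleR_A_J scaleR_left_commute)
  then show "c *\<^sub>R J h x - h *\<^sub>R A (c *\<^sub>R J h x) = c *\<^sub>R x" by (simp add: scaleR_diff_right)
qed (use assms J_spec in auto)

lemma J_diff: "h > 0 \<Longrightarrow> J h (x - y) = J h x - J h y"
  using J_add[of h x "- y"] J_scaleR[of h "-1" y] by simp

lemma J_contraction: "h > 0 \<Longrightarrow> norm (J h x) \<le> norm x"
  using norm_le_resolvent_eq[of "J h x" h] J_spec[of h x] by simp

lemma A_J:
  assumes "h > 0" "x \<in> D"
  shows "A (J h x) \<in> D" "A (J h x) = J h (A x)"
proof -
  note J = J_spec[OF assms(1), of x]
  have *: "A (J h x) = (1 / h) *\<^sub>R (J h x - x)"
    using assms(1) by (simp flip: scaleR_A_J[OF assms(1)])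
  show D: "A (J h x) \<in> D" unfolding * using J assms by (intro D_intros) auto
  have "A (J h x) - h *\<^sub>R A (A (J h x)) = A (J h x - h *\<^sub>R A (J h x))"
    using J(1) D by (simp add: A_diff A_scaleR D_intros)
  also have "\<dots> = A x" by (simp only: J(2))
  finally show "A (J h x) = J h (A x)"
    by (rule J_unique[OF assms(1) D, symmetric])
qed

lemma J_commute:
  assumes "h > 0" "k > 0"
  shows "J h (J k y) = J k (J h y)"
proof -
  let ?x = "J k y"
  note k = J_spec[OF assms(2), of y]
  note h = J_spec[OF assms(1), of ?x]
  have "J h y = J h (?x - k *\<^sub>R A ?x)" by (simp only: k)
  also have "\<dots> = J h ?x - k *\<^sub>R A (J h ?x)"
    using assms k(1) by (simp add: J_diff J_scaleR A_J)
  finally show "J h ?x = J k (J h y)"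
    by (intro J_unique[OF assms(2) h(1), symmetric]) (rule sym)
qed

lemma norm_J_diff_le:
  assumes "h > 0" "x \<in> D"
  shows "norm (J h x - x) \<le> h * norm (A x)"
proof -
  have "J h x - x = h *\<^sub>R J h (A x)"
    using scaleR_A_J[OF assms(1), of x] A_J[OF assms] by simp
  then show ?thesis using J_contraction[OF assms(1), of "A x"] assms by simp
qed

text \<open>One Euler step of length \<open>h\<close> against two of length \<open>h / 2\<close>. With \<open>y\<close> the result of the two short
  steps, \<open>y - h A y = x - (h / 2)\<^sup>2 A (A y)\<close>, so the difference is \<open>J h\<close> applied to
  \<open>(h / 2)\<^sup>2 A (A y)\<close>.\<close>

lemma norm_J_halving_le:
  assumes h: "h > 0" and x: "x \<in> D" "A x \<in> D"
  shows "norm (J h x - J (h/2) (J (h/2) x)) \<le> h\<^sup>2 / 4 * norm (A (A x))"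
proof -
  define k where "k = h / 2"
  have k: "k > 0" "h = 2 * k" using h by (auto simp: k_def)
  define z where "z = J k x"
  define y where "y = J k z"
  have z: "z \<in> D" "z - k *\<^sub>R A z = x" "A z \<in> D" unfolding z_def by (rule J_spec[OF k(1)] A_J(1)[OF k(1) x(1)])+
  have y: "y \<in> D" "y - k *\<^sub>R A y = z" "A y \<in> D" unfolding y_def by (rule J_spec[OF k(1)] A_J(1)[OF k(1) z(1)])+
  have AAy: "A (A y) = J k (J k (A (A x)))"
    using A_J k x z by (simp add: y_def z_def)
  have "y - h *\<^sub>R A y = x - (k\<^sup>2) *\<^sub>R A (A y)"
  proof -
    have "A z = A y - k *\<^sub>R A (A y)" using y by (metis A_diff A_scaleR D_intros(3))
    then have "x = (y - k *\<^sub>R A y) - k *\<^sub>R (A y - k *\<^sub>R A (A y))"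
      by (simp only: y(2) z(2) flip: \<open>A z = A y - k *\<^sub>R A (A y)\<close>)
    also have "\<dots> = y - h *\<^sub>R A y + (k\<^sup>2) *\<^sub>R A (A y)"
      by (simp add: k(2) scaleR_diff_right power2_eq_square scaleR_2 flip: scaleR_scaleR)
    finally show ?thesis by simp
  qed
  then have "J h (x - (k\<^sup>2) *\<^sub>R A (A y)) = y" by (rule J_unique[OF h y(1)])
  then have "J h x - (k\<^sup>2) *\<^sub>R J h (A (A y)) = y"
    by (simp only: J_diff[OF h] J_scaleR[OF h])
  then have "J h x - y = (k\<^sup>2) *\<^sub>R J h (A (A y))"
    by (metis add_diff_cancel_left' diff_diff_eq2)
  then have "norm (J h x - y) \<le> k\<^sup>2 * norm (A (A y))"
    using J_contraction[OF h] by (simp add: mult_left_mono)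
  also have "norm (A (A y)) \<le> norm (A (A x))"
    unfolding AAy using J_contraction[OF k(1)] order_trans by blast
  finally show ?thesis using k by (simp add: y_def z_def mult_left_mono)
qed

lemma J_tendsto:
  assumes "(h \<longlongrightarrow> 0) F" "eventually (\<lambda>n. h n > 0) F"
  shows "((\<lambda>n. J (h n) x) \<longlongrightarrow> x) F"
proof (rule tendstoI)
  fix e :: real assume e: "e > 0"
  have "x \<in> closure D" using dense by (simp add: densely_defined_def)
  then have "\<forall>e>0. \<exists>y\<in>D. dist y x < e" by (simp add: closure_approachable)
  from this[rule_format, of "e/4"] e obtain y where y: "y \<in> D" "dist y x < e/4" by auto
  have "((\<lambda>n. h n * norm (A y)) \<longlongrightarrow> 0 * norm (A y)) F" by (intro tendsto_intros assms)
  then have "eventually (\<lambda>n. h n * norm (A y) < e/2) F"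
    by (rule order_tendstoD) (use e in auto)
  with assms(2) show "eventually (\<lambda>n. dist (J (h n) x) x < e) F"
  proof eventually_elim
    case (elim n)
    have "J (h n) x - x = J (h n) (x - y) + (J (h n) y - y) + (y - x)"
      using elim by (simp add: J_diff)
    then have "norm (J (h n) x - x) \<le> norm (J (h n) (x - y)) + norm (J (h n) y - y) + norm (y - x)"
      by (metis norm_triangle_ineq norm_triangle_mono order_refl)
    also have "norm (J (h n) (x - y)) \<le> norm (y - x)"
      using J_contraction[of "h n" "x - y"] elim by (simp add: norm_minus_commute)
    also have "norm (J (h n) y - y) \<le> h n * norm (A y)" using norm_J_diff_le elim y by blast
    finally show ?case using y elim by (simp add: dist_norm)
  qed
qed

text \<open>The square of a resolvent maps into the domain of \<open>A\<^sup>2\<close>, which is therefore dense.\<close>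

lemma dense_domain_square: "\<exists>y. y \<in> D \<and> A y \<in> D \<and> norm (y - x) < e" if "e > 0"
proof -
  have "((\<lambda>n. J (1 / real (Suc n)) x) \<longlongrightarrow> x) sequentially"
    by (rule J_tendsto) (use LIMSEQ_inverse_real_of_nat in \<open>auto simp: inverse_eq_divide simp del: of_nat_Suc\<close>)
  then have "eventually (\<lambda>n. dist (J (1 / real (Suc n)) x) x < e/2) sequentially"
    by (rule tendstoD) (use that in auto)
  then obtain n where "dist (J (1 / real (Suc n)) x) x < e/2"
    using eventually_happens' sequentially_bot by blast
  then obtain h where h: "h > 0" "norm (J h x - x) < e/2"
    by (metis dist_norm of_nat_0_less_iff zero_less_Suc zero_less_divide_1_iff)
  have "norm (J h (J h x) - J h x) \<le> norm (J h x - x)"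
    using J_contraction[OF h(1), of "J h x - x"] h by (simp add: J_diff)
  then have "norm (J h (J h x) - x) < e"
    using h norm_triangle_ineq[of "J h (J h x) - J h x" "J h x - x"] by simp
  then show ?thesis using J_spec[OF h(1)] A_J[OF h(1)] by metis
qed

end

section \<open>Generation of a semigroup by implicit Euler approximation\<close>

context max_dissipative
begin

lemma J_pow_diff: "h > 0 \<Longrightarrow> (J h ^^ n) (x - y) = (J h ^^ n) x - (J h ^^ n) y"
  by (induction n) (auto simp: J_diff)

lemma J_pow_add: "h > 0 \<Longrightarrow> (J h ^^ n) (x + y) = (J h ^^ n) x + (J h ^^ n) y"
  by (induction n) (auto simp: J_add)

lemma J_pow_scaleR: "h > 0 \<Longrightarrow> (J h ^^ n) (c *\<^sub>R x) = c *\<^sub>R (J h ^^ n) x"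
  by (induction n) (auto simp: J_scaleR)

lemma J_pow_contraction: "h > 0 \<Longrightarrow> norm ((J h ^^ n) x) \<le> norm x"
  by (induction n) (auto intro: order_trans[OF J_contraction])

lemma J_pow_commute: "h > 0 \<Longrightarrow> k > 0 \<Longrightarrow> (J h ^^ n) (J k x) = J k ((J h ^^ n) x)"
  by (induction n) (auto simp: J_commute)

lemma A_J_pow:
  assumes "h > 0" "x \<in> D"
  shows "(J h ^^ n) x \<in> D \<and> A ((J h ^^ n) x) = (J h ^^ n) (A x)"
  using assms by (induction n) (auto simp: J_spec A_J)

lemma norm_J_pow_diff_le:
  assumes "h > 0" "x \<in> D"
  shows "norm ((J h ^^ n) x - x) \<le> real n * h * norm (A x)"
proof (induction n)
  case (Suc n)
  have "(J h ^^ Suc n) x - x = J h ((J h ^^ n) x - x) + (J h x - x)"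
    using assms by (simp add: J_diff)
  then have "norm ((J h ^^ Suc n) x - x) \<le> norm (J h ((J h ^^ n) x - x)) + norm (J h x - x)"
    by (metis norm_triangle_ineq)
  also have "norm (J h ((J h ^^ n) x - x)) \<le> real n * h * norm (A x)"
    using order_trans[OF J_contraction[OF assms(1)] Suc] .
  also have "norm (J h x - x) \<le> h * norm (A x)" using norm_J_diff_le[OF assms] .
  finally show ?case by (simp add: algebra_simps)
qed simp

text \<open>The two powers are powers of the commuting contractions \<open>J h\<close> and \<open>(J (h / 2))\<^sup>2\<close>; the local errors
  add up.\<close>

lemma norm_J_pow_halving_le:
  assumes "h > 0"
  shows "norm ((J h ^^ m) x - (J (h/2) ^^ (2 * m)) x) \<le> real m * norm (J h x - J (h/2) (J (h/2) x))"
proof (induction m)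
  case (Suc m)
  let ?k = "h/2" and ?P = "J h ^^ m" and ?Q = "J (h/2) ^^ (2*m)"
  have k: "?k > 0" using assms by simp
  have "(J h ^^ Suc m) x = ?P (J h x)" by (simp add: funpow_swap1)
  moreover have "(J ?k ^^ (2 * Suc m)) x = J ?k (J ?k (?Q x))" by simp
  moreover have "?P (J ?k (J ?k x)) = J ?k (J ?k (?P x))" using assms k by (simp add: J_pow_commute)
  ultimately have "(J h ^^ Suc m) x - (J ?k ^^ (2 * Suc m)) x =
      ?P (J h x - J ?k (J ?k x)) + J ?k (J ?k (?P x - ?Q x))"
    using assms k by (simp add: J_pow_diff J_diff)
  then have "norm ((J h ^^ Suc m) x - (J ?k ^^ (2 * Suc m)) x) \<le>
      norm (?P (J h x - J ?k (J ?k x))) + norm (J ?k (J ?k (?P x - ?Q x)))"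
    by (metis norm_triangle_ineq)
  also have "norm (?P (J h x - J ?k (J ?k x))) \<le> norm (J h x - J ?k (J ?k x))"
    by (rule J_pow_contraction[OF assms])
  also have "norm (J ?k (J ?k (?P x - ?Q x))) \<le> norm (?P x - ?Q x)"
    using order_trans[OF J_contraction[OF k] J_contraction[OF k]] .
  also note Suc
  finally show ?case by (simp add: algebra_simps)
qed simp

text \<open>The Euler approximation at time \<open>t\<close> with dyadic step \<open>2\<^sup>-\<^sup>n\<close> and \<open>\<lfloor>2\<^sup>n t\<rfloor>\<close> steps, and its limit \<open>T t\<close>.
  Dyadic steps make consecutive approximations comparable by halving.\<close>

definition euler :: "nat \<Rightarrow> real \<Rightarrow> 'a \<Rightarrow> 'a" where
  "euler n t x = (J ((1/2)^n) ^^ nat \<lfloor>t * 2^n\<rfloor>) x"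

definition T :: "real \<Rightarrow> 'a \<Rightarrow> 'a" where
  "T t x = lim (\<lambda>n. euler n t x)"

lemma euler_diff: "euler n t (x - y) = euler n t x - euler n t y"
  by (simp add: euler_def J_pow_diff)

lemma euler_contraction: "norm (euler n t x) \<le> norm x"
  by (simp add: euler_def J_pow_contraction)

lemma euler_dist: "dist (euler n t x) (euler n t y) \<le> dist x y"
  by (simp add: dist_norm euler_contraction flip: euler_diff)

lemma steps_le: "t \<ge> 0 \<Longrightarrow> real (nat \<lfloor>t * 2^n\<rfloor>) * (1/2)^n \<le> t"
  by (simp add: power_one_over divide_simps)

text \<open>Halving the step replaces \<open>m\<close> steps by \<open>2 m\<close> or \<open>2 m + 1\<close> steps, the latter because of rounding.\<close>

lemma euler_step:
  assumes t: "t \<ge> 0" and x: "x \<in> D" "A x \<in> D"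
  shows "dist (euler n t x) (euler (Suc n) t x) \<le> (1/2)^n * (t * norm (A (A x)) + norm (A x))"
proof -
  define h :: real where "h = (1/2)^n"
  have h: "h > 0" by (simp add: h_def)
  define m where "m = nat \<lfloor>t * 2^n\<rfloor>"
  define m' where "m' = nat \<lfloor>t * 2^Suc n\<rfloor>"
  have m': "m' = 2 * m \<or> m' = Suc (2 * m)"
    using t unfolding m_def m'_def by (simp; linarith)
  have mh: "real m * h \<le> t" using steps_le[OF t, of n] by (simp add: m_def h_def)
  let ?y = "(J (h/2) ^^ (2 * m)) x"
  have "norm ((J h ^^ m) x - ?y) \<le> real m * (h\<^sup>2 / 4 * norm (A (A x)))"
    by (rule order_trans[OF norm_J_pow_halving_le[OF h]])
       (intro mult_left_mono norm_J_halving_le h x, simp)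
  also have "\<dots> = (real m * h) * (h / 4 * norm (A (A x)))" by (simp add: power2_eq_square)
  also have "\<dots> \<le> t * (h * norm (A (A x)))"
    using h t mh by (intro mult_mono) auto
  finally have 1: "norm ((J h ^^ m) x - ?y) \<le> t * (h * norm (A (A x)))" .
  have "norm (?y - (J (h/2) ^^ m') x) \<le> h * norm (A x)"
    using m'
  proof
    assume "m' = Suc (2 * m)"
    then have "?y - (J (h/2) ^^ m') x = (J (h/2) ^^ (2*m)) (x - J (h/2) x)"
      using h by (simp add: J_pow_diff funpow_swap1)
    then have "norm (?y - (J (h/2) ^^ m') x) \<le> norm (x - J (h/2) x)"
      using h by (simp add: J_pow_contraction)
    also have "\<dots> \<le> h / 2 * norm (A x)"
      using norm_J_diff_le[of "h/2" x] h x by (simp add: norm_minus_commute)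
    also have "\<dots> \<le> h * norm (A x)" using h by (intro mult_right_mono) auto
    finally show ?thesis .
  qed (use h in simp)
  then have "norm ((J h ^^ m) x - (J (h/2) ^^ m') x) \<le> t * (h * norm (A (A x))) + h * norm (A x)"
    using 1 norm_triangle_ineq[of "(J h ^^ m) x - ?y" "?y - (J (h/2) ^^ m') x"] by simp
  then show ?thesis
    by (simp add: euler_def dist_norm m_def m'_def h_def algebra_simps)
qed

lemma euler_convergent:
  assumes t: "t \<ge> 0"
  shows "(\<lambda>n. euler n t x) \<longlonglongrightarrow> T t x"
proof -
  have 1: "Cauchy (\<lambda>n. euler n t y)" if y: "y \<in> D" "A y \<in> D" for y
  proof -
    have "summable (\<lambda>n. euler (Suc n) t y - euler n t y)"
    proof (rule summable_comparison_test')
      show "summable (\<lambda>n. (1/2)^n * (t * norm (A (A y)) + norm (A y)))"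
        by (intro summable_mult2 summable_geometric) simp
      show "norm (euler (Suc n) t y - euler n t y) \<le> (1/2)^n * (t * norm (A (A y)) + norm (A y))"
        for n using euler_step[OF t y, of n] by (simp add: dist_norm norm_minus_commute)
    qed
    then have "convergent (\<lambda>n. \<Sum>i<n. euler (Suc i) t y - euler i t y)"
      by (simp add: summable_iff_convergent)
    then have "convergent (\<lambda>n. euler n t y - euler 0 t y)"
      unfolding sum_lessThan_telescope[of "\<lambda>n. euler n t y"] .
    then show ?thesis by (simp add: convergent_diff_const_right_iff Cauchy_convergent_iff)
  qed
  have "Cauchy (\<lambda>n. euler n t x)"
  proof (rule metric_CauchyI)
    fix e :: real assume e: "e > 0"
    then obtain y where y: "y \<in> D" "A y \<in> D" "norm (y - x) < e/3"
      using dense_domain_square[of "e/3" x] by auto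
    obtain N where N: "\<And>i j. i \<ge> N \<Longrightarrow> j \<ge> N \<Longrightarrow> dist (euler i t y) (euler j t y) < e/3"
      using metric_CauchyD[OF 1[OF y(1,2)], of "e/3"] e by auto
    have "dist (euler i t x) (euler j t x) < e" if "i \<ge> N" "j \<ge> N" for i j
    proof -
      have "dist (euler n t x) (euler n t y) < e/3" for n
        using euler_dist[of n t x y] y(3) by (simp add: dist_norm norm_minus_commute)
      from this[of i] this[of j] N[OF that] show ?thesis
        using dist_triangle[of "euler i t x" "euler j t x" "euler i t y"]
          dist_triangle[of "euler i t y" "euler j t x" "euler j t y"]
        by (simp add: dist_commute)
    qed
    then show "\<exists>M. \<forall>i\<ge>M. \<forall>j\<ge>M. dist (euler i t x) (euler j t x) < e" by blast
  qed
  then show ?thesis by (simp add: T_def Cauchy_convergent_iff convergent_LIMSEQ_iff)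
qed

lemma T_contraction: "t \<ge> 0 \<Longrightarrow> norm (T t x) \<le> norm x"
  by (rule Lim_norm_ubound[OF _ euler_convergent]) (auto simp: euler_contraction)

lemma T_bounded_linear:
  assumes t: "t \<ge> 0"
  shows "bounded_linear (T t)"
proof (rule bounded_linear_intro[where K = 1])
  note c = euler_convergent[OF t]
  show "T t (x + y) = T t x + T t y" for x y
    using tendsto_add[OF c[of x] c[of y]] c[of "x + y"]
    by (intro LIMSEQ_unique) (auto simp: euler_def J_pow_add)
  show "T t (r *\<^sub>R x) = r *\<^sub>R T t x" for r x
    using tendsto_scaleR[OF tendsto_const c[of x]] c[of "r *\<^sub>R x"]
    by (intro LIMSEQ_unique) (auto simp: euler_def J_pow_scaleR)
qed (use T_contraction[OF t] in simp)

lemma T_zero: "T 0 = id"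
  by (auto simp: T_def euler_def lim_const)

lemma T_add:
  assumes "s \<ge> 0" "t \<ge> 0"
  shows "T (s + t) x = T s (T t x)"
proof -
  have "(\<lambda>n. euler n s (T t x)) \<longlonglongrightarrow> T s (T t x)" by (rule euler_convergent[OF assms(1)])
  moreover have "(\<lambda>n. euler n s (euler n t x) - euler n s (T t x)) \<longlonglongrightarrow> 0"
  proof (rule Lim_null_comparison)
    show "eventually (\<lambda>n. norm (euler n s (euler n t x) - euler n s (T t x)) \<le> norm (euler n t x - T t x)) sequentially"
      by (simp add: euler_contraction flip: euler_diff)
    show "(\<lambda>n. norm (euler n t x - T t x)) \<longlonglongrightarrow> 0"
      using euler_convergent[OF assms(2), of x] by (intro tendsto_norm_zero) (simp add: LIM_zero_iff)
  qed
  moreover have "(\<lambda>n. euler n (s + t) x - euler n s (euler n t x)) \<longlonglongrightarrow> 0"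
  proof (rule Lim_null_comparison)
    show "eventually (\<lambda>n. norm (euler n (s + t) x - euler n s (euler n t x)) \<le> norm (J ((1/2)^n) x - x)) sequentially"
    proof (rule always_eventually, rule allI)
      fix n :: nat
      define h :: real where "h = (1/2)^n"
      have h: "h > 0" by (simp add: h_def)
      define a b c where "a = nat \<lfloor>s * 2^n\<rfloor>" and "b = nat \<lfloor>t * 2^n\<rfloor>" and "c = nat \<lfloor>(s + t) * 2^n\<rfloor>"
      have "s * 2^n \<ge> 0" "t * 2^n \<ge> 0" using assms by auto
      then have "c = a + b \<or> c = Suc (a + b)"
        unfolding a_def b_def c_def distrib_right by linarith
      then have "norm ((J h ^^ c) x - (J h ^^ a) ((J h ^^ b) x)) \<le> norm (J h x - x)"
      proof
        assume c: "c = Suc (a + b)"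
        have "(J h ^^ c) x - (J h ^^ a) ((J h ^^ b) x) = (J h ^^ (a + b)) (J h x - x)"
          using h by (simp add: c J_pow_diff funpow_add funpow_swap1)
        then show ?thesis using J_pow_contraction[OF h] by simp
      qed (simp add: funpow_add)
      then show "norm (euler n (s + t) x - euler n s (euler n t x)) \<le> norm (J ((1/2)^n) x - x)"
        by (simp add: euler_def a_def b_def c_def h_def)
    qed
    show "(\<lambda>n. norm (J ((1/2)^n) x - x)) \<longlonglongrightarrow> 0"
      by (intro tendsto_norm_zero) (simp add: LIM_zero_iff J_tendsto LIMSEQ_realpow_zero)
  qed
  ultimately have "(\<lambda>n. (euler n (s + t) x - euler n s (euler n t x)) +
      (euler n s (euler n t x) - euler n s (T t x)) + euler n s (T t x)) \<longlonglongrightarrow> 0 + 0 + T s (T t x)"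
    by (intro tendsto_add)
  then have "(\<lambda>n. euler n (s + t) x) \<longlonglongrightarrow> T s (T t x)" by simp
  with euler_convergent[of "s + t" x] assms show ?thesis by (intro LIMSEQ_unique) auto
qed

lemma norm_T_diff_le:
  assumes "t \<ge> 0" "x \<in> D"
  shows "norm (T t x - x) \<le> t * norm (A x)"
proof (rule Lim_norm_ubound)
  show "(\<lambda>n. euler n t x - x) \<longlonglongrightarrow> T t x - x"
    by (intro tendsto_intros euler_convergent assms)
  show "eventually (\<lambda>n. norm (euler n t x - x) \<le> t * norm (A x)) sequentially"
  proof (rule always_eventually, rule allI)
    fix n
    have "norm (euler n t x - x) \<le> real (nat \<lfloor>t * 2^n\<rfloor>) * (1/2)^n * norm (A x)"
      unfolding euler_def by (rule norm_J_pow_diff_le) (use assms in auto)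
    also have "\<dots> \<le> t * norm (A x)" using steps_le[OF assms(1)] by (intro mult_right_mono) auto
    finally show "norm (euler n t x - x) \<le> t * norm (A x)" .
  qed
qed simp

text \<open>The Euler approximation satisfies
  \<open>J\<^sup>m x - x = h (J (A x) + \<dots> + J\<^sup>m (A x))\<close>, and each summand is close to \<open>A x\<close>. The vector \<open>z\<close>
  is a regular approximation of \<open>A x\<close>, which itself need not lie in the domain.\<close>

lemma norm_J_pow_taylor_le:
  assumes h: "h > 0" and x: "x \<in> D" and z: "z \<in> D"
  shows "norm ((J h ^^ m) x - x - (real m * h) *\<^sub>R A x)
           \<le> real m * h * (2 * norm (A x - z) + real m * h * norm (A z))"
proof (induction m)
  case (Suc m)
  let ?P = "J h ^^ m" and ?Q = "J h ^^ Suc m"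
  have PD: "?P x \<in> D" "A (?P x) = ?P (A x)" using A_J_pow[OF h x] by auto
  have "?Q x - ?P x = h *\<^sub>R ?Q (A x)"
    using scaleR_A_J[OF h, of "?P x"] A_J[OF h PD(1)] PD(2) by simp
  then have eq: "?Q x - x - (real (Suc m) * h) *\<^sub>R A x =
      (?P x - x - (real m * h) *\<^sub>R A x) + h *\<^sub>R (?Q (A x) - A x)"
    by (simp add: algebra_simps)
  have "?Q (A x) - A x = ?Q (A x - z) + (?Q z - z) + (z - A x)"
    unfolding J_pow_diff[OF h] by simp
  then have "norm (?Q (A x) - A x) \<le> norm (?Q (A x - z)) + norm (?Q z - z) + norm (z - A x)"
    by (metis norm_triangle_ineq norm_triangle_mono order_refl)
  also have "\<dots> \<le> norm (A x - z) + real (Suc m) * h * norm (A z) + norm (A x - z)"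
    by (intro add_mono J_pow_contraction norm_J_pow_diff_le h z) (simp add: norm_minus_commute)
  finally have "norm (?Q (A x) - A x) \<le> 2 * norm (A x - z) + real (Suc m) * h * norm (A z)"
    by simp
  then have "norm (h *\<^sub>R (?Q (A x) - A x)) \<le> h * (2 * norm (A x - z) + real (Suc m) * h * norm (A z))"
    using h by (simp add: mult_left_mono)
  moreover have "norm (?P x - x - (real m * h) *\<^sub>R A x)
      \<le> real m * h * (2 * norm (A x - z) + real (Suc m) * h * norm (A z))"
    using h by (intro order_trans[OF Suc] mult_left_mono add_left_mono mult_right_mono) auto
  ultimately have "norm (?Q x - x - (real (Suc m) * h) *\<^sub>R A x) \<le>
     real m * h * (2 * norm (A x - z) + real (Suc m) * h * norm (A z)) +
     h * (2 * norm (A x - z) + real (Suc m) * h * norm (A z))"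
    unfolding eq by (meson add_mono norm_triangle_ineq order_trans)
  also have "\<dots> = real (Suc m) * h * (2 * norm (A x - z) + real (Suc m) * h * norm (A z))"
    by (simp only: of_nat_Suc) (simp only: algebra_simps)
  finally show ?case .
qed simp

lemma norm_T_taylor_le:
  assumes t: "t \<ge> 0" and x: "x \<in> D" and z: "z \<in> D"
  shows "norm (T t x - x - t *\<^sub>R A x) \<le> t * (2 * norm (A x - z) + t * norm (A z))"
proof (rule Lim_norm_ubound)
  let ?m = "\<lambda>n. real (nat \<lfloor>t * 2^n\<rfloor>) * (1/2)^n"
  have "?m \<longlonglongrightarrow> t"
  proof (rule tendsto_sandwich)
    have "(\<lambda>n. t - (1/2)^n) \<longlonglongrightarrow> t - (0::real)"
      by (intro tendsto_intros LIMSEQ_realpow_zero) auto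
    then show "(\<lambda>n. t - (1/2)^n) \<longlonglongrightarrow> t" by simp
    show "eventually (\<lambda>n. t - (1/2)^n \<le> ?m n) sequentially"
    proof (rule always_eventually, rule allI)
      fix n :: nat
      have "t * 2^n - 1 \<le> real (nat \<lfloor>t * 2^n\<rfloor>)" using t by linarith
      then have "(t * 2^n - 1) * (1/2)^n \<le> ?m n" by (intro mult_right_mono) auto
      moreover have "(t * 2^n - 1) * (1/2)^n = t - (1/2)^n" by (simp add: power_one_over field_simps)
      ultimately show "t - (1/2)^n \<le> ?m n" by simp
    qed
  qed (use steps_le[OF t] in auto)
  then show "(\<lambda>n. euler n t x - x - ?m n *\<^sub>R A x) \<longlonglongrightarrow> T t x - x - t *\<^sub>R A x"
    by (intro tendsto_intros euler_convergent t)
  show "eventually (\<lambda>n. norm (euler n t x - x - ?m n *\<^sub>R A x) \<le> t * (2 * norm (A x - z) + t * norm (A z))) sequentially"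
  proof (rule always_eventually, rule allI)
    fix n :: nat
    have "norm (euler n t x - x - ?m n *\<^sub>R A x) \<le> ?m n * (2 * norm (A x - z) + ?m n * norm (A z))"
      unfolding euler_def by (rule norm_J_pow_taylor_le) (use x z in auto)
    also have "\<dots> \<le> t * (2 * norm (A x - z) + t * norm (A z))"
      using steps_le[OF t, of n] t by (intro mult_mono add_left_mono mult_right_mono) auto
    finally show "norm (euler n t x - x - ?m n *\<^sub>R A x) \<le> t * (2 * norm (A x - z) + t * norm (A z))" .
  qed
qed simp

lemma T_tendsto: "((\<lambda>t. T t x) \<longlongrightarrow> x) (at_right 0)"
proof (rule tendstoI)
  fix e :: real assume e: "e > 0"
  then obtain y where y: "y \<in> D" "norm (y - x) < e/4" using dense_domain_square[of "e/4" x] by auto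
  have "((\<lambda>t. t * norm (A y)) \<longlongrightarrow> 0 * norm (A y)) (at_right 0)" by (intro tendsto_intros)
  then have "eventually (\<lambda>t. t * norm (A y) < e/2) (at_right 0)"
    by (rule order_tendstoD) (use e in auto)
  moreover have "eventually (\<lambda>t::real. t > 0) (at_right 0)" by (simp add: eventually_at_right_less)
  ultimately show "eventually (\<lambda>t. dist (T t x) x < e) (at_right 0)"
  proof eventually_elim
    case (elim t)
    interpret T: bounded_linear "T t" using elim by (intro T_bounded_linear) simp
    have "T t x - x = T t (x - y) + (T t y - y) + (y - x)" by (simp add: T.diff)
    then have "norm (T t x - x) \<le> norm (T t (x - y)) + norm (T t y - y) + norm (y - x)"
      by (metis norm_triangle_ineq norm_triangle_mono order_refl)
    moreover have "norm (T t (x - y)) \<le> norm (y - x)"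
      using T_contraction[of t "x - y"] elim by (simp add: norm_minus_commute)
    moreover have "norm (T t y - y) \<le> t * norm (A y)" using norm_T_diff_le elim y by simp
    ultimately show ?case using y elim by (simp add: dist_norm)
  qed
qed

lemma T_derivative:
  assumes x: "x \<in> D"
  shows "((\<lambda>t. (T t x - x) /\<^sub>R t) \<longlongrightarrow> A x) (at_right 0)"
proof (rule tendstoI)
  fix e :: real assume e: "e > 0"
  then obtain z where z: "z \<in> D" "norm (z - A x) < e/4" using dense_domain_square[of "e/4" "A x"] by auto
  have "((\<lambda>t. t * norm (A z)) \<longlongrightarrow> 0 * norm (A z)) (at_right 0)" by (intro tendsto_intros)
  then have "eventually (\<lambda>t. t * norm (A z) < e/2) (at_right 0)"
    by (rule order_tendstoD) (use e in auto)
  moreover have "eventually (\<lambda>t::real. t > 0) (at_right 0)" by (simp add: eventually_at_right_less)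
  ultimately show "eventually (\<lambda>t. dist ((T t x - x) /\<^sub>R t) (A x) < e) (at_right 0)"
  proof eventually_elim
    case (elim t)
    have "(T t x - x) /\<^sub>R t - A x = (T t x - x - t *\<^sub>R A x) /\<^sub>R t"
      using elim by (simp add: scaleR_diff_right)
    then have "t * norm ((T t x - x) /\<^sub>R t - A x) = norm (T t x - x - t *\<^sub>R A x)"
      using elim by simp
    also have "\<dots> \<le> t * (2 * norm (A x - z) + t * norm (A z))"
      using norm_T_taylor_le[of t x z] elim x z by simp
    finally have "norm ((T t x - x) /\<^sub>R t - A x) \<le> 2 * norm (A x - z) + t * norm (A z)"
      using elim by simp
    then show ?case using z elim by (simp add: dist_norm norm_minus_commute)
  qed
qed

lemma C0_semigroup_T: "C0_semigroup T"
  unfolding C0_semigroup_def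
  using T_bounded_linear T_zero T_add T_tendsto by auto

text \<open>If the difference quotient of \<open>x\<close> converges to \<open>y\<close>, then \<open>x\<close> lies in the domain: \<open>x - y = z - A z\<close>
  for some \<open>z\<close> in the domain, and the generator maps \<open>w = x - z\<close> to itself, hence \<open>w = 0\<close> by
  dissipativity.\<close>

lemma generates_T: "generates D A T"
  unfolding generates_def
proof (intro conjI allI iffI)
  fix x y
  assume lim: "((\<lambda>t. (T t x - x) /\<^sub>R t) \<longlongrightarrow> y) (at_right 0)"
  obtain z where z: "z \<in> D" "z - A z = x - y" using range[of 1 "x - y"] by auto
  define w where "w = x - z"
  have "((\<lambda>t. (T t x - x) /\<^sub>R t - (T t z - z) /\<^sub>R t) \<longlongrightarrow> y - A z) (at_right 0)"
    by (intro tendsto_diff lim T_derivative z)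
  then have "((\<lambda>t. ((T t x - x) /\<^sub>R t - (T t z - z) /\<^sub>R t) \<bullet> w) \<longlongrightarrow> (y - A z) \<bullet> w) (at_right 0)"
    by (intro tendsto_inner tendsto_const)
  moreover have "eventually (\<lambda>t::real. t > 0) (at_right 0)" by (simp add: eventually_at_right_less)
  then have "eventually (\<lambda>t. ((T t x - x) /\<^sub>R t - (T t z - z) /\<^sub>R t) \<bullet> w \<le> 0) (at_right 0)"
  proof eventually_elim
    case (elim t)
    interpret T: bounded_linear "T t" using elim by (intro T_bounded_linear) simp
    have "(T t w - w) \<bullet> w \<le> 0"
    proof -
      have "T t w \<bullet> w \<le> norm (T t w) * norm w" by (rule norm_cauchy_schwarz)
      also have "\<dots> \<le> norm w * norm w" using T_contraction[of t w] elim by (intro mult_right_mono) auto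
      finally show ?thesis by (simp add: inner_diff_left power2_norm_eq_inner flip: power2_eq_square)
    qed
    moreover have "(T t x - x) /\<^sub>R t - (T t z - z) /\<^sub>R t = (T t w - w) /\<^sub>R t"
      by (simp add: w_def T.diff algebra_simps)
    ultimately show ?case using elim by (simp add: mult_nonneg_nonpos)
  qed
  ultimately have "(y - A z) \<bullet> w \<le> 0"
    by (rule tendsto_upperbound) simp
  moreover have "y - A z = w" using z by (simp add: w_def algebra_simps)
  ultimately have "w \<bullet> w \<le> 0" by simp
  then have "w = 0" by (metis inner_eq_zero_iff inner_ge_zero order_antisym)
  then show "x \<in> D" "A x = y" using z by (auto simp: w_def)
qed (use C0_semigroup_T T_derivative in auto)

end

text \<open>The range of \<open>I - h A\<close> is closed because \<open>A\<close> is closed and dissipative. A vector \<open>y\<close> orthogonal to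
  it satisfies \<open>A\<^sup>* y = y / h\<close>, and so vanishes as the adjoint is dissipative.\<close>

lemma max_dissipative_of_adjoint:
  fixes D :: "'a::{real_inner, banach} set"
  assumes lin: "linear_operator_on D A" and dense: "densely_defined D" and cl: "closed_operator D A"
    and dis: "dissipative D A" and dis': "dissipative (adjoint_domain D A) (adjoint_op D A)"
  shows "max_dissipative D A"
proof
  fix h :: real and y :: 'a
  assume h: "h > 0"
  have sub: "subspace D"
    and add: "\<And>x y. x \<in> D \<Longrightarrow> y \<in> D \<Longrightarrow> A (x + y) = A x + A y"
    and scale: "\<And>x c. x \<in> D \<Longrightarrow> A (c *\<^sub>R x) = c *\<^sub>R A x"
    using lin by (auto simp: linear_operator_on_def)
  have diff: "A (x - y) = A x - A y" if "x \<in> D" "y \<in> D" for x y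
    using add[of x "- y"] scale[of y "-1"] subspace_neg[OF sub, of y] that by simp
  define R where "R = (\<lambda>x. x - h *\<^sub>R A x) ` D"
  have bd: "norm x \<le> norm (x - h *\<^sub>R A x)" if "x \<in> D" for x
    using that h dis by (intro norm_le_of_inner_nonpos) (simp add: dissipative_def mult_nonneg_nonpos)
  have "subspace R"
    unfolding subspace_def R_def
  proof (intro conjI ballI allI)
    have "0 \<in> D" using sub by (rule subspace_0)
    moreover have "A 0 = 0" using scale[OF \<open>0 \<in> D\<close>, of 0] by simp
    ultimately show "0 \<in> (\<lambda>x. x - h *\<^sub>R A x) ` D"
      by (intro image_eqI[of _ _ 0]) auto
  next
    fix u v assume "u \<in> (\<lambda>x. x - h *\<^sub>R A x) ` D" "v \<in> (\<lambda>x. x - h *\<^sub>R A x) ` D"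
    then obtain a b where "a \<in> D" "b \<in> D" "u = a - h *\<^sub>R A a" "v = b - h *\<^sub>R A b" by auto
    then show "u + v \<in> (\<lambda>x. x - h *\<^sub>R A x) ` D"
      using sub by (intro image_eqI[of _ _ "a + b"]) (simp_all add: add subspace_add scaleR_add_right)
  next
    fix c u assume "u \<in> (\<lambda>x. x - h *\<^sub>R A x) ` D"
    then obtain a where "a \<in> D" "u = a - h *\<^sub>R A a" by auto
    then show "c *\<^sub>R u \<in> (\<lambda>x. x - h *\<^sub>R A x) ` D"
      using sub by (intro image_eqI[of _ _ "c *\<^sub>R a"]) (simp_all add: scale subspace_scale scaleR_diff_right)
  qed
  moreover have "closed R"
    unfolding closed_sequential_limits
  proof (intro allI impI, elim conjE)
    fix u l assume u: "\<forall>n. u n \<in> R" and l: "u \<longlonglongrightarrow> l"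
    then have "\<forall>n. \<exists>x. x \<in> D \<and> u n = x - h *\<^sub>R A x" by (auto simp: R_def)
    then obtain x where x: "\<And>n. x n \<in> D" "\<And>n. u n = x n - h *\<^sub>R A (x n)" by metis
    have le: "dist (x i) (x j) \<le> dist (u i) (u j)" for i j
    proof -
      have "u i - u j = (x i - x j) - h *\<^sub>R A (x i - x j)"
        by (simp add: x diff scaleR_diff_right)
      then show ?thesis using bd[of "x i - x j"] x(1) sub by (simp add: dist_norm subspace_diff)
    qed
    have "Cauchy x"
      using LIMSEQ_imp_Cauchy[OF l] le unfolding Cauchy_def by (meson le_less_trans)
    then obtain p where p: "x \<longlonglongrightarrow> p" using Cauchy_convergent_iff convergent_def by blast
    have "(\<lambda>n. (1/h) *\<^sub>R (x n - u n)) \<longlonglongrightarrow> (1/h) *\<^sub>R (p - l)" by (intro tendsto_intros p l)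
    moreover have "(1/h) *\<^sub>R (x n - u n) = A (x n)" for n using h by (simp add: x)
    ultimately have lim: "(\<lambda>n. (x n, A (x n))) \<longlonglongrightarrow> (p, (1/h) *\<^sub>R (p - l))"
      by (intro tendsto_Pair p) simp
    have "(x n, A (x n)) \<in> (\<lambda>x. (x, A x)) ` D" for n using x(1) by blast
    then have "(p, (1/h) *\<^sub>R (p - l)) \<in> (\<lambda>x. (x, A x)) ` D"
      using closed_sequentially[OF cl[unfolded closed_operator_def] _ lim] by blast
    then have "p \<in> D" "A p = (1/h) *\<^sub>R (p - l)" by auto
    then show "l \<in> R" using h unfolding R_def by (intro image_eqI[of _ _ p]) auto
  qed
  moreover have "y = 0" if y: "\<forall>m\<in>R. m \<bullet> y = 0" for y
  proof -
    have ad: "A x \<bullet> y = x \<bullet> ((1/h) *\<^sub>R y)" if "x \<in> D" for x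
    proof -
      have "(x - h *\<^sub>R A x) \<bullet> y = 0" using y that by (auto simp: R_def)
      then show ?thesis using h by (simp add: inner_diff_left field_simps)
    qed
    have "adjoint_op D A y = (1/h) *\<^sub>R y"
      unfolding adjoint_op_def
    proof (rule the_equality)
      fix z assume z: "\<forall>x\<in>D. A x \<bullet> y = x \<bullet> z"
      have "closure D \<subseteq> {x. x \<bullet> (z - (1/h) *\<^sub>R y) = 0}"
        using z ad by (intro closure_minimal closed_Collect_eq continuous_intros)
                      (auto simp: inner_diff_right)
      then have "(z - (1/h) *\<^sub>R y) \<bullet> (z - (1/h) *\<^sub>R y) = 0"
        using dense unfolding densely_defined_def by blast
      then show "z = (1/h) *\<^sub>R y" by simp
    qed (use ad in blast)
    moreover have "y \<in> adjoint_domain D A" using ad unfolding adjoint_domain_def by blast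
    ultimately have "(1/h) * (y \<bullet> y) \<le> 0" using dis' by (auto simp: dissipative_def)
    then have "y \<bullet> y \<le> 0" using h by (simp add: divide_le_0_iff)
    then show "y = 0" by (metis inner_eq_zero_iff inner_ge_zero order_antisym)
  qed
  ultimately have "y \<in> R" using closed_subspace_orthogonal_nonzero by blast
  then show "\<exists>x\<in>D. x - h *\<^sub>R A x = y" by (auto simp: R_def)
qed (fact lin dense dis)+

section \<open>Contractivity and continuity of the generated semigroup\<close>

text \<open>Uniform boundedness near zero from pointwise boundedness, by the Baire category theorem.\<close>

lemma C0_semigroup_locally_bounded:
  fixes S :: "real \<Rightarrow> 'a::banach \<Rightarrow> 'a"
  assumes S: "C0_semigroup S"
  shows "\<exists>\<delta>>0. \<exists>M. \<forall>t\<in>{0..\<delta>}. \<forall>x. norm (S t x) \<le> M * norm x"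
proof -
  have bl: "bounded_linear (S t)" if "t \<ge> 0" for t
    using S that by (simp add: C0_semigroup_def)
  define F where "F n = {x. \<forall>t\<in>{0..1 / real (Suc n)}. norm (S t x) \<le> real (Suc n)}" for n
  have "closed (F n)" for n
  proof -
    have "F n = (\<Inter>t\<in>{0..1 / real (Suc n)}. {x. norm (S t x) \<le> real (Suc n)})" 
      by (auto simp: F_def)
    moreover have "closed {x. norm (S t x) \<le> real (Suc n)}" if "t \<ge> 0" for t
      by (intro closed_Collect_le continuous_intros bounded_linear.continuous_on[OF bl[OF that]])
    ultimately show ?thesis by (auto intro!: closed_INT)
  qed
  moreover have "(\<Union>n. F n) = UNIV"
  proof (intro equalityI subsetI UNIV_I)
    fix x
    have "((\<lambda>t. norm (S t x)) \<longlongrightarrow> norm x) (at_right 0)"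
      using S by (intro tendsto_norm) (simp add: C0_semigroup_def)
    then have "eventually (\<lambda>t. norm (S t x) < norm x + 1) (at_right 0)"
      by (rule order_tendstoD) simp
    then obtain b where b: "b > 0" "\<And>t. t > 0 \<Longrightarrow> t < b \<Longrightarrow> norm (S t x) < norm x + 1"
      by (auto simp: eventually_at_right_field)
    obtain n where n: "real n > max (1 / b) (norm x + 1)" using reals_Archimedean2 by blast
    have "1 / real (Suc n) < b"
    proof -
      have "1 / b < real (Suc n)" using n by simp
      then show ?thesis using b(1) by (simp add: field_simps del: of_nat_Suc)
    qed
    moreover have "S 0 x = x" using S by (simp add: C0_semigroup_def)
    ultimately have "norm (S t x) \<le> real (Suc n)" if "t \<in> {0..1 / real (Suc n)}" for t
      using b(2)[of t] n that by (cases "t = 0") auto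
    then have "x \<in> F n" unfolding F_def by blast
    then show "x \<in> (\<Union>n. F n)" by blast
  qed
  moreover have "completely_metrizable_space (euclidean :: 'a topology)"
    by (rule completely_metrizable_space_euclidean)
  ultimately have "(\<forall>n. interior (F n) = {}) \<Longrightarrow> interior (UNIV :: 'a set) = {}"
    using Baire_category_alt[of "euclidean :: 'a topology" "range F"]
    by auto
  then obtain n where "interior (F n) \<noteq> {}" by auto
  then obtain x r where r: "r > 0" "ball x r \<subseteq> F n"
    by (metis all_not_in_conv mem_interior)
  define N where "N = real (Suc n)"
  have "norm (S t z) \<le> (4 * N / r) * norm z" if t: "t \<in> {0..1 / N}" for t z
  proof (cases "z = 0")
    case True
    then show ?thesis using linear_0[OF bounded_linear.linear[OF bl[of t]]] t by simp
  next
    case False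
    interpret St: bounded_linear "S t" using bl t by simp
    define c where "c = r / (2 * norm z)"
    have c: "c > 0" using r False by (simp add: c_def)
    have "x + c *\<^sub>R z \<in> F n" "x \<in> F n"
      using r False by (auto intro!: subsetD[OF r(2)] simp: c_def dist_norm)
    then have "norm (S t (x + c *\<^sub>R z)) \<le> N" "norm (S t x) \<le> N"
      using t unfolding F_def N_def by blast+
    moreover have "c *\<^sub>R S t z = S t (x + c *\<^sub>R z) - S t x" by (simp add: St.add St.scaleR)
    ultimately have "norm (c *\<^sub>R S t z) \<le> N + N" by (metis norm_triangle_ineq4 order_trans add_mono)
    then have "c * norm (S t z) \<le> 2 * N" using c by simp
    then show ?thesis using r False c by (simp add: c_def field_simps)
  qed
  moreover have "1 / N > 0" by (simp add: N_def)
  ultimately show ?thesis by blast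
qed

text \<open>The last time at which \<open>f\<close> lies below the line through \<open>(a, f a)\<close> with small slope \<open>d > 0\<close> must
  be \<open>b\<close>.\<close>

lemma nonincreasing_of_right_derivative:
  fixes f :: "real \<Rightarrow> real"
  assumes ab: "a \<le> b" and cont: "continuous_on {a..b} f"
    and deriv: "\<And>s. a \<le> s \<Longrightarrow> s < b \<Longrightarrow> \<exists>l\<le>0. ((\<lambda>h. (f (s + h) - f s) / h) \<longlongrightarrow> l) (at_right 0)"
  shows "f b \<le> f a"
proof (rule field_le_epsilon)
  fix e :: real assume e: "e > 0"
  define d where "d = e / (b - a + 1)"
  have d: "d > 0" "d * (b - a) \<le> e" using e ab by (auto simp: d_def field_simps)
  define g where "g t = f t - d * (t - a)" for t
  let ?Z = "{t\<in>{a..b}. g t \<le> g a}"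
  have "continuous_on {a..b} g" unfolding g_def by (intro continuous_intros cont)
  then have "closed ?Z" by (intro continuous_on_closed_Collect_le continuous_on_const) auto
  moreover have "bounded ?Z" by (rule bounded_subset[of "{a..b}"]) auto
  moreover have "a \<in> ?Z" using ab by simp
  ultimately have "\<exists>s\<in>?Z. \<forall>t\<in>?Z. t \<le> s"
    by (intro compact_attains_sup) (blast intro: compact_eq_bounded_closed[THEN iffD2])+
  then obtain s where s: "s \<in> ?Z" "\<And>t. t \<in> ?Z \<Longrightarrow> t \<le> s" by blast
  have "s = b"
  proof (rule ccontr)
    assume "s \<noteq> b"
    then have sb: "a \<le> s" "s < b" using s by auto
    then obtain l where l: "l \<le> 0" "((\<lambda>h. (f (s + h) - f s) / h) \<longlongrightarrow> l) (at_right 0)"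
      using deriv by blast
    have "eventually (\<lambda>h. (f (s + h) - f s) / h < d) (at_right 0)"
      by (rule order_tendstoD[OF l(2)]) (use l d in auto)
    moreover have "eventually (\<lambda>h. h \<in> {0<..<b - s}) (at_right 0)"
      by (rule eventually_at_right_real) (use sb in auto)
    ultimately have "eventually (\<lambda>h. (f (s + h) - f s) / h < d \<and> h \<in> {0<..<b - s}) (at_right 0)"
      by (rule eventually_conj)
    then obtain h where h: "(f (s + h) - f s) / h < d" "h > 0" "h < b - s"
      using eventually_happens'[of "at_right (0::real)"] by auto
    then have "f (s + h) - f s < d * h" by (simp add: field_simps)
    then have "g (s + h) \<le> g s" by (simp add: g_def algebra_simps)
    then have "s + h \<in> ?Z" using s(1) h by auto
    from s(2)[OF this] h show False by simp
  qed
  then show "f b \<le> f a + e" using s(1) d by (simp add: g_def)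
qed

text \<open>Strongly continuous semigroups of contractions on a Hilbert space.\<close>

locale contraction_semigroup =
  fixes S :: "real \<Rightarrow> 'a::{real_inner, banach} \<Rightarrow> 'a"
  assumes C0: "C0_semigroup S"
    and contraction: "t \<ge> 0 \<Longrightarrow> norm (S t x) \<le> norm x"

text \<open>Generation does not include contractivity. Continuity of the orbits, required by the argument
  with right derivatives, is available first on the interval where the semigroup is bounded; the
  semigroup law extends contractivity from there to all times.\<close>

lemma (in max_dissipative) generates_imp_contraction:
  assumes gen: "generates D A S"
  shows "contraction_semigroup S"
proof
  show C0: "C0_semigroup S" using gen by (simp add: generates_def)
  have bl: "bounded_linear (S t)" if "t \<ge> 0" for t
    using C0 that by (simp add: C0_semigroup_def)
  have S0: "S 0 x = x" for x using C0 by (simp add: C0_semigroup_def)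
  have Sadd: "S (s + t) x = S s (S t x)" if "s \<ge> 0" "t \<ge> 0" for s t x
    using C0 that by (simp add: C0_semigroup_def)
  obtain \<delta> M where \<delta>: "\<delta> > 0" and M': "\<forall>t\<in>{0..\<delta>}. \<forall>x. norm (S t x) \<le> M * norm x"
    using C0_semigroup_locally_bounded[OF C0] by blast
  have M: "norm (S t x) \<le> M * norm x" if "t \<ge> 0" "t \<le> \<delta>" for t x
    using M' that by simp
  have cont: "continuous_on {0..\<delta>} (\<lambda>t. S t x)" for x
  proof -
    show ?thesis
      unfolding continuous_on_iff
    proof (intro ballI allI impI)
      fix t e :: real assume t: "t \<in> {0..\<delta>}" and e: "e > 0"
      have "((\<lambda>h. (\<bar>M\<bar> + 1) * norm (S h x - x)) \<longlongrightarrow> (\<bar>M\<bar> + 1) * norm (x - x)) (at_right 0)"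
        using C0 by (intro tendsto_intros) (simp add: C0_semigroup_def)
      then have "eventually (\<lambda>h. (\<bar>M\<bar> + 1) * norm (S h x - x) < e) (at_right 0)"
        by (rule order_tendstoD) (use e in simp)
      then obtain b where b: "b > 0" "\<And>h. h > 0 \<Longrightarrow> h < b \<Longrightarrow> (\<bar>M\<bar> + 1) * norm (S h x - x) < e"
        by (auto simp: eventually_at_right_field)
      have *: "norm (S (s + h) x - S s x) < e" if "s \<ge> 0" "s \<le> \<delta>" "h > 0" "h < b" for s h
      proof -
        interpret Ss: bounded_linear "S s" using bl that by simp
        have "S (s + h) x - S s x = S s (S h x - x)" using that by (simp add: Sadd Ss.diff)
        then have "norm (S (s + h) x - S s x) \<le> M * norm (S h x - x)" using M that by metis
        also have "\<dots> \<le> (\<bar>M\<bar> + 1) * norm (S h x - x)" by (intro mult_right_mono) auto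
        also have "\<dots> < e" using b that by blast
        finally show ?thesis .
      qed
      have "dist (S t' x) (S t x) < e" if "t' \<in> {0..\<delta>}" "dist t' t < b" for t'
      proof -
        consider "t' = t" | "t' > t" | "t' < t" by linarith
        then show ?thesis
        proof cases
          case 2
          then show ?thesis using *[of t "t' - t"] t that by (auto simp: dist_norm)
        next
          case 3
          then show ?thesis using *[of t' "t - t'"] t that by (auto simp: dist_norm norm_minus_commute)
        qed (use e in simp)
      qed
      then show "\<exists>d>0. \<forall>t'\<in>{0..\<delta>}. dist t' t < d \<longrightarrow> dist (S t' x) (S t x) < e" using b(1) by blast
    qed
  qed
  \<comment> \<open>For \<open>x\<close> in the domain, \<open>|S(s) x|\<^sup>2\<close> has the right derivative \<open>2 A (S(s) x) \<bullet> S(s) x \<le> 0\<close>.\<close>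
  have onD: "norm (S t x) \<le> norm x" if x: "x \<in> D" and t: "0 \<le> t" "t \<le> \<delta>" for x t
  proof -
    have deriv: "\<exists>l\<le>0. ((\<lambda>h. ((norm (S (s + h) x))\<^sup>2 - (norm (S s x))\<^sup>2) / h) \<longlongrightarrow> l) (at_right 0)"
      if s: "0 \<le> s" for s
    proof -
      interpret Ss: bounded_linear "S s" using bl s by simp
      let ?y = "S s x"
      have "((\<lambda>h. (S h x - x) /\<^sub>R h) \<longlongrightarrow> A x) (at_right 0)"
        using gen x by (auto simp: generates_def)
      then have lim0: "((\<lambda>h. S s ((S h x - x) /\<^sub>R h)) \<longlongrightarrow> S s (A x)) (at_right 0)"
        by (rule Ss.tendsto)
      have "eventually (\<lambda>h::real. h > 0) (at_right 0)" by (simp add: eventually_at_right_less)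
      then have ev: "eventually (\<lambda>h. S s ((S h x - x) /\<^sub>R h) = (S h ?y - ?y) /\<^sub>R h) (at_right 0)"
      proof eventually_elim
        case (elim h)
        have "S s (S h x) = S h (S s x)" using Sadd[of s h x] Sadd[of h s x] s elim by (simp add: add.commute)
        then show ?case by (simp add: Ss.scaleR Ss.diff)
      qed
      have lim: "((\<lambda>h. (S h ?y - ?y) /\<^sub>R h) \<longlongrightarrow> S s (A x)) (at_right 0)"
        by (rule Lim_transform_eventually[OF lim0 ev])
      then have "?y \<in> D" "A ?y = S s (A x)" using gen by (auto simp: generates_def)
      then have neg: "2 * (A ?y \<bullet> ?y) \<le> 0" using dissip by (auto simp: dissipative_def)
      have "((\<lambda>h. h *\<^sub>R ((S h ?y - ?y) /\<^sub>R h) + ?y) \<longlongrightarrow> 0 *\<^sub>R S s (A x) + ?y) (at_right 0)"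
        by (intro tendsto_intros lim)
      then have "((\<lambda>h. ((S h ?y - ?y) /\<^sub>R h) \<bullet> ((h *\<^sub>R ((S h ?y - ?y) /\<^sub>R h) + ?y) + ?y))
           \<longlongrightarrow> S s (A x) \<bullet> ((0 *\<^sub>R S s (A x) + ?y) + ?y)) (at_right 0)"
        by (intro tendsto_intros lim)
      then have L: "((\<lambda>h. ((S h ?y - ?y) /\<^sub>R h) \<bullet> ((h *\<^sub>R ((S h ?y - ?y) /\<^sub>R h) + ?y) + ?y))
           \<longlongrightarrow> 2 * (A ?y \<bullet> ?y)) (at_right 0)"
        by (simp add: \<open>A ?y = S s (A x)\<close> inner_add_right)
      have "eventually (\<lambda>h::real. h > 0) (at_right 0)" by (simp add: eventually_at_right_less)
      then have "eventually (\<lambda>h. ((S h ?y - ?y) /\<^sub>R h) \<bullet> ((h *\<^sub>R ((S h ?y - ?y) /\<^sub>R h) + ?y) + ?y)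
          = ((norm (S (s + h) x))\<^sup>2 - (norm (S s x))\<^sup>2) / h) (at_right 0)"
      proof eventually_elim
        case (elim h)
        have 1: "S (s + h) x = S h ?y" using Sadd[of h s x] s elim by (simp add: add.commute)
        have 2: "h *\<^sub>R ((S h ?y - ?y) /\<^sub>R h) + ?y = S h ?y" using elim by simp
        have 3: "(S h ?y - ?y) \<bullet> (S h ?y + ?y) = (norm (S h ?y))\<^sup>2 - (norm ?y)\<^sup>2"
          by (simp add: power2_norm_eq_inner inner_diff_left inner_diff_right inner_add_right inner_commute)
        show ?case unfolding 1 2 inner_scaleR_left 3 by (simp add: divide_inverse)
      qed
      with L have "((\<lambda>h. ((norm (S (s + h) x))\<^sup>2 - (norm (S s x))\<^sup>2) / h) \<longlongrightarrow> 2 * (A ?y \<bullet> ?y)) (at_right 0)"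
        by (rule Lim_transform_eventually)
      with neg show ?thesis by blast
    qed
    have "(norm (S t x))\<^sup>2 \<le> (norm (S 0 x))\<^sup>2"
    proof (rule nonincreasing_of_right_derivative[OF t(1)])
      show "continuous_on {0..t} (\<lambda>t. (norm (S t x))\<^sup>2)"
        by (intro continuous_intros continuous_on_subset[OF cont]) (use t in auto)
    qed (use deriv in auto)
    then show ?thesis by (simp add: S0)
  qed
  have small: "norm (S t x) \<le> norm x" if t: "0 \<le> t" "t \<le> \<delta>" for x t
  proof -
    have "closure D \<subseteq> {x. norm (S t x) \<le> norm x}"
      by (intro closure_minimal closed_Collect_le continuous_intros bounded_linear.continuous_on[OF bl])
         (use onD t in auto)
    then show ?thesis using dense by (auto simp: densely_defined_def)
  qed
  fix t :: real and x assume t: "t \<ge> 0"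
  obtain n where n: "t / \<delta> < real n" using reals_Archimedean2 by blast
  then have n0: "n > 0" using t \<delta> by (cases n) (auto simp: divide_less_0_iff)
  define r where "r = t / real n"
  have r: "r \<ge> 0" "r \<le> \<delta>" "real n * r = t" using n n0 t \<delta> by (auto simp: r_def field_simps)
  have "norm (S (real k * r) x) \<le> norm x" for k
  proof (induction k)
    case (Suc k)
    have "S (real (Suc k) * r) x = S r (S (real k * r) x)"
      using Sadd[of r "real k * r" x] r by (simp add: algebra_simps)
    then show ?case using small[OF r(1,2)] Suc order_trans by metis
  qed (simp add: S0)
  from this[of n] r show "norm (S t x) \<le> norm x" by simp
qed

context contraction_semigroup
begin

lemma linear_S: "t \<ge> 0 \<Longrightarrow> bounded_linear (S t)"
  and S_zero: "S 0 x = x"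
  and S_add: "s \<ge> 0 \<Longrightarrow> t \<ge> 0 \<Longrightarrow> S (s + t) x = S s (S t x)"
  and S_tendsto: "((\<lambda>t. S t x) \<longlongrightarrow> x) (at_right 0)"
  using C0 by (auto simp: C0_semigroup_def)

lemma S_diff: "t \<ge> 0 \<Longrightarrow> S t (x - y) = S t x - S t y"
  by (rule linear_diff[OF bounded_linear.linear[OF linear_S]])

lemma dist_S_le: "t \<ge> 0 \<Longrightarrow> dist (S t x) (S t y) \<le> dist x y"
  using contraction[of t "x - y"] by (simp add: dist_norm S_diff)

lemma S_near_zero:
  assumes "e > 0"
  obtains b where "b > 0" "\<And>h. 0 \<le> h \<Longrightarrow> h < b \<Longrightarrow> dist (S h x) x < e"
proof -
  obtain b where b: "b > 0" "\<And>h. h > 0 \<Longrightarrow> h < b \<Longrightarrow> dist (S h x) x < e"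
    using tendstoD[OF S_tendsto assms] by (auto simp: eventually_at_right_field)
  show thesis
  proof (rule that[OF b(1)])
    fix h :: real assume "0 \<le> h" "h < b"
    then show "dist (S h x) x < e" using b(2)[of h] assms by (cases "h = 0") (auto simp: S_zero)
  qed
qed

lemma dist_S_S_le:
  assumes "s \<ge> 0" "t \<ge> 0"
  shows "dist (S s x) (S t x) \<le> dist (S \<bar>s - t\<bar> x) x"
proof -
  have *: "dist (S s x) (S t x) \<le> dist (S (s - t) x) x" if "t \<ge> 0" "s \<ge> t" for s t
    using dist_S_le[of t "S (s - t) x" x] S_add[of t "s - t" x] that by simp
  show ?thesis
    using *[of t s] *[of s t] assms by (cases "s \<ge> t") (auto simp: dist_commute abs_if)
qed

text \<open>Joint strong continuity in time and space.\<close>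

lemma continuous_on_S:
  assumes "continuous_on X f" "continuous_on X g" "\<And>x. x \<in> X \<Longrightarrow> f x \<ge> 0"
  shows "continuous_on X (\<lambda>x. S (f x) (g x))"
proof -
  have "continuous_on ({0..} \<times> UNIV) (\<lambda>(t, x). S t x)"
    unfolding continuous_on_iff
  proof (intro ballI allI impI)
    fix p :: "real \<times> 'a" and e :: real assume p: "p \<in> {0..} \<times> UNIV" and e: "e > 0"
    obtain t x where [simp]: "p = (t, x)" by (cases p)
    obtain b where b: "b > 0" "\<And>h. 0 \<le> h \<Longrightarrow> h < b \<Longrightarrow> dist (S h x) x < e/2"
      using S_near_zero[of "e/2" x] e by auto
    have "dist (S s y) (S t x) < e" if "s \<ge> 0" "dist (s, y) (t, x) < min b (e/2)" for s y
    proof -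
      have "dist s t < b" "dist y x < e/2"
        using that dist_fst_le[of "(s, y)" "(t, x)"] dist_snd_le[of "(s, y)" "(t, x)"] by auto
      moreover have "dist (S s y) (S s x) \<le> dist y x" by (rule dist_S_le[OF that(1)])
      moreover have "dist (S s x) (S t x) \<le> dist (S \<bar>s - t\<bar> x) x"
        by (rule dist_S_S_le) (use p that in auto)
      ultimately show ?thesis
        using dist_triangle[of "S s y" "S t x" "S s x"] b(2)[of "\<bar>s - t\<bar>"] by (simp add: dist_real_def)
    qed
    then show "\<exists>d>0. \<forall>q\<in>{0..} \<times> UNIV. dist q p < d \<longrightarrow>
        dist (case q of (t, x) \<Rightarrow> S t x) (case p of (t, x) \<Rightarrow> S t x) < e"
      using b e by (intro exI[of _ "min b (e/2)"]) auto
  qed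
  then have "continuous_on X (\<lambda>x. case (f x, g x) of (t, x) \<Rightarrow> S t x)"
    by (rule continuous_on_compose2) (use assms in \<open>auto intro!: continuous_intros\<close>)
  then show ?thesis by simp
qed

lemma uniform_near_zero_on_compact:
  assumes K: "compact K" and e: "e > 0"
  obtains b where "b > 0" "\<And>h x. 0 \<le> h \<Longrightarrow> h < b \<Longrightarrow> x \<in> K \<Longrightarrow> dist (S h x) x < e"
proof -
  have "uniformly_continuous_on ({0..1} \<times> K) (\<lambda>p. S (fst p) (snd p))"
    by (intro compact_uniformly_continuous continuous_on_S compact_Times K continuous_intros) auto
  then obtain d where d: "d > 0" "\<And>p q. p \<in> {0..1} \<times> K \<Longrightarrow> q \<in> {0..1} \<times> K \<Longrightarrow> dist q p < d
      \<Longrightarrow> dist (S (fst q) (snd q)) (S (fst p) (snd p)) < e"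
    using e unfolding uniformly_continuous_on_def by meson
  show thesis
  proof (rule that[of "min d 1"])
    fix h :: real and x assume "0 \<le> h" "h < min d 1" "x \<in> K"
    then show "dist (S h x) x < e"
      using d(2)[of "(0, x)" "(h, x)"] by (simp add: dist_Pair_Pair S_zero)
  qed (use d in auto)
qed

end

lemma max_dissipative_semigroup_of:
  assumes "max_dissipative D A"
  shows "contraction_semigroup (semigroup_of D A)"
proof -
  interpret max_dissipative D A by fact
  have "generates D A (semigroup_of D A)"
    unfolding semigroup_of_def by (rule someI[where P = "generates D A", OF generates_T])
  then show ?thesis by (rule generates_imp_contraction)
qed

section \<open>The energy inequality for mild solutions\<close>

context contraction_semigroup
begin

text \<open>\<open>u\<close> is a mild solution of \<open>u' = A u + f(t)\<close> on \<open>[0, \<tau>]\<close>, with initial value \<open>u 0\<close>.\<close>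

definition mild_on :: "real \<Rightarrow> (real \<Rightarrow> 'a) \<Rightarrow> (real \<Rightarrow> 'a) \<Rightarrow> bool" where
  "mild_on \<tau> f u \<longleftrightarrow> continuous_on {0..\<tau>} u \<and>
     (\<forall>t\<in>{0..\<tau>}. ((\<lambda>s. S (t - s) (f s)) has_integral (u t - S t (u 0))) {0..t})"

lemma mild_on_step:
  assumes u: "mild_on \<tau> f u" and ab: "0 \<le> a" "a \<le> b" "b \<le> \<tau>"
  shows "((\<lambda>s. S (b - s) (f s)) has_integral (u b - S (b - a) (u a))) {a..b}"
proof -
  have a: "((\<lambda>s. S (a - s) (f s)) has_integral (u a - S a (u 0))) {0..a}"
    and b: "((\<lambda>s. S (b - s) (f s)) has_integral (u b - S b (u 0))) {0..b}"
    using u ab by (auto simp: mild_on_def)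
  have X: "(S (b - a) \<circ> (\<lambda>s. S (a - s) (f s)) has_integral S (b - a) (u a - S a (u 0))) {0..a}"
    by (rule has_integral_linear[OF a linear_S]) (use ab in simp)
  have E: "S (b - a) (S (a - s) (f s)) = S (b - s) (f s)" if "s \<in> {0..a}" for s
    using S_add[of "b - a" "a - s" "f s"] that ab by simp
  have "((\<lambda>s. S (b - s) (f s)) has_integral S (b - a) (u a - S a (u 0))) {0..a}"
    by (rule has_integral_eq[OF _ X]) (simp add: E)
  moreover have "S (b - a) (u a - S a (u 0)) = S (b - a) (u a) - S b (u 0)"
    using S_add[of "b - a" a "u 0"] ab by (simp add: S_diff)
  ultimately have 1: "((\<lambda>s. S (b - s) (f s)) has_integral S (b - a) (u a) - S b (u 0)) {0..a}"
    by simp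
  have "(\<lambda>s. S (b - s) (f s)) integrable_on {a..b}"
    by (rule integrable_subinterval_real[OF has_integral_integrable[OF b]]) (use ab in auto)
  then obtain i where i: "((\<lambda>s. S (b - s) (f s)) has_integral i) {a..b}" by blast
  have "S (b - a) (u a) - S b (u 0) + i = u b - S b (u 0)"
    using has_integral_unique[OF has_integral_combine[OF ab(1,2) 1 i] b] .
  then have "i = u b - S (b - a) (u a)" by (simp add: algebra_simps)
  with i show ?thesis by simp
qed

lemma mild_on_shift:
  assumes u: "mild_on \<tau> f u" and ab: "0 \<le> a" "a + \<sigma> \<le> \<tau>"
  shows "mild_on \<sigma> (\<lambda>s. f (a + s)) (\<lambda>t. u (a + t))"
  unfolding mild_on_def
proof (intro conjI ballI)
  show "continuous_on {0..\<sigma>} (\<lambda>t. u (a + t))"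
    by (rule continuous_on_compose2[of "{0..\<tau>}" u])
       (use u ab in \<open>auto simp: mild_on_def intro!: continuous_intros\<close>)
  fix t assume t: "t \<in> {0..\<sigma>}"
  have "((\<lambda>s. S (a + t - s) (f s)) has_integral (u (a + t) - S (a + t - a) (u a))) {a..a+t}"
    by (rule mild_on_step[OF u]) (use t ab in auto)
  from has_integral_shift_real_ivl[OF this, of a]
  show "((\<lambda>s. S (t - s) (f (a + s))) has_integral u (a + t) - S t (u (a + 0))) {0..t}"
    by (simp add: add.commute)
qed

lemma mild_on_diff:
  assumes "mild_on \<tau> f u" "mild_on \<tau> g w"
  shows "mild_on \<tau> (\<lambda>s. f s - g s) (\<lambda>t. u t - w t)"
  unfolding mild_on_def
proof (intro conjI ballI)
  show "continuous_on {0..\<tau>} (\<lambda>t. u t - w t)"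
    using assms by (auto simp: mild_on_def intro!: continuous_intros)
  fix t assume t: "t \<in> {0..\<tau>}"
  have "((\<lambda>s. S (t - s) (f s) - S (t - s) (g s)) has_integral
      (u t - S t (u 0)) - (w t - S t (w 0))) {0..t}"
    by (rule has_integral_diff) (use assms t in \<open>auto simp: mild_on_def\<close>)
  moreover have "(u t - S t (u 0)) - (w t - S t (w 0)) = u t - w t - S t (u 0 - w 0)"
    using t by (simp add: S_diff)
  ultimately have "((\<lambda>s. S (t - s) (f s) - S (t - s) (g s)) has_integral
      u t - w t - S t (u 0 - w 0)) {0..t}" by simp
  then show "((\<lambda>s. S (t - s) (f s - g s)) has_integral u t - w t - S t (u 0 - w 0)) {0..t}"
    by (rule has_integral_eq[rotated]) (simp add: S_diff)
qed

text \<open>Each interval of length \<open>h\<close> contributes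
  \<open>|u(a+h)|\<^sup>2 \<le> |u(a)|\<^sup>2 + 2 c \<bullet> I + |I|\<^sup>2\<close>, where \<open>c = S(h) u(a)\<close> and \<open>I\<close> is the integral of
  \<open>S(a + h - s) f(s)\<close>. The last term is of order \<open>h\<^sup>2\<close>, and in the cross term \<open>c\<close> and
  \<open>S(a + h - s) f(s)\<close> are uniformly close to \<open>u(s)\<close> and \<open>f(s)\<close>.\<close>

lemma energy_inequality:
  assumes u: "mild_on \<tau> f u" and \<tau>: "\<tau> \<ge> 0"
    and K: "compact K" "\<And>s. s \<in> {0..\<tau>} \<Longrightarrow> f s \<in> K"
    and e: "continuous_on {0..\<tau>} e" "\<And>s. s \<in> {0..\<tau>} \<Longrightarrow> f s \<bullet> u s \<le> e s"
  shows "(norm (u \<tau>))\<^sup>2 \<le> (norm (u 0))\<^sup>2 + 2 * integral {0..\<tau>} e"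
proof (cases "\<tau> = 0")
  case False
  then have \<tau>0: "\<tau> > 0" using \<tau> by simp
  have cu: "continuous_on {0..\<tau>} u" using u by (simp add: mild_on_def)
  define L where "L = u ` {0..\<tau>}"
  have L: "compact L" unfolding L_def by (intro compact_continuous_image cu) auto
  obtain M where M: "M > 0" "\<And>x. x \<in> K \<Longrightarrow> norm x \<le> M"
    using compact_imp_bounded[OF K(1)] by (auto simp: bounded_pos)
  obtain N where N: "N > 0" "\<And>x. x \<in> L \<Longrightarrow> norm x \<le> N"
    using compact_imp_bounded[OF L] by (auto simp: bounded_pos)
  have ie: "e integrable_on {a..b}" if "0 \<le> a" "b \<le> \<tau>" for a b
    by (intro integrable_continuous_interval continuous_on_subset[OF e(1)]) (use that in auto)
  define C where "C = 2 * (2 * M + N) + M\<^sup>2"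
  have C: "C > 0" using M N by (simp add: C_def add_pos_nonneg)
  have approx: "(norm (u \<tau>))\<^sup>2 \<le> (norm (u 0))\<^sup>2 + 2 * integral {0..\<tau>} e + \<tau> * C * \<eta>"
    if \<eta>: "\<eta> > 0" for \<eta>
  proof -
    obtain b where b: "b > 0" "\<And>h x. 0 \<le> h \<Longrightarrow> h < b \<Longrightarrow> x \<in> K \<union> L \<Longrightarrow> dist (S h x) x < \<eta>"
      using uniform_near_zero_on_compact[of "K \<union> L" \<eta>] K(1) L \<eta> by (metis compact_Un)
    have "uniformly_continuous_on {0..\<tau>} u" by (rule compact_uniformly_continuous[OF cu]) simp
    then obtain d where d: "d > 0" "\<And>s t. s \<in> {0..\<tau>} \<Longrightarrow> t \<in> {0..\<tau>} \<Longrightarrow> dist s t < d \<Longrightarrow> dist (u s) (u t) < \<eta>"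
      using \<eta> unfolding uniformly_continuous_on_def by metis
    have step: "(norm (u (a + h)))\<^sup>2 \<le> (norm (u a))\<^sup>2 + 2 * integral {a..a+h} e + h * C * \<eta>"
      if a: "0 \<le> a" "a + h \<le> \<tau>" and h: "0 \<le> h" "h < b" "h < d" "h \<le> \<eta>" for a h
    proof -
      define c where "c = S h (u a)"
      define I where "I = u (a + h) - c"
      have "((\<lambda>s. S (a + h - s) (f s)) has_integral (u (a + h) - S (a + h - a) (u a))) {a..a+h}"
        by (rule mild_on_step[OF u]) (use a h in auto)
      then have I: "((\<lambda>s. S (a + h - s) (f s)) has_integral I) {a..a+h}"
        by (simp add: I_def c_def)
      have sI: "s \<in> {0..\<tau>}" if "s \<in> {a..a+h}" for s using that a by auto
      have fM: "norm (S (a + h - s) (f s)) \<le> M" if "s \<in> {a..a+h}" for s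
        using contraction[of "a + h - s" "f s"] M(2)[OF K(2)[OF sI[OF that]]] that by simp
      have "norm I \<le> M * measure lborel (cbox a (a + h))"
        by (rule has_integral_bound[of M]) (use I fM M in \<open>auto simp: box_real\<close>)
      then have nI: "norm I \<le> M * h" using h by simp
      have le: "c \<bullet> S (a + h - s) (f s) \<le> e s + \<eta> * (2 * M + N)" if s: "s \<in> {a..a+h}" for s
      proof -
        have s\<tau>: "s \<in> {0..\<tau>}" "a \<in> {0..\<tau>}" using sI[OF s] a h by auto
        have "dist c (u a) < \<eta>" unfolding c_def using s\<tau> h by (intro b) (auto simp: L_def)
        moreover have "dist (u a) (u s) < \<eta>" using s\<tau> s h by (intro d) (auto simp: dist_real_def)
        ultimately have 1: "norm (c - u s) \<le> 2 * \<eta>"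
          using dist_triangle[of c "u s" "u a"] by (simp add: dist_norm)
        have 2: "norm (S (a + h - s) (f s) - f s) \<le> \<eta>"
          using b(2)[of "a + h - s" "f s"] K(2)[OF s\<tau>(1)] s h by (simp add: dist_norm)
        have "c \<bullet> S (a + h - s) (f s) = (c - u s) \<bullet> S (a + h - s) (f s)
            + u s \<bullet> (S (a + h - s) (f s) - f s) + f s \<bullet> u s"
          by (simp add: inner_diff_left inner_diff_right inner_commute)
        also have "\<dots> \<le> norm (c - u s) * norm (S (a + h - s) (f s))
            + norm (u s) * norm (S (a + h - s) (f s) - f s) + e s"
          by (intro add_mono norm_cauchy_schwarz e s\<tau>)
        also have "\<dots> \<le> 2 * \<eta> * M + N * \<eta> + e s"
          using 1 2 fM[OF s] N M \<eta> s\<tau> by (intro add_mono mult_mono) (auto simp: L_def)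
        finally show ?thesis by (simp add: algebra_simps)
      qed
      have i1: "((\<lambda>s. c \<bullet> S (a + h - s) (f s)) has_integral c \<bullet> I) {a..a+h}"
        using has_integral_linear[OF I bounded_linear_inner_right[of c]] by (simp add: o_def)
      have i2: "((\<lambda>s. e s + \<eta> * (2 * M + N)) has_integral
          integral {a..a+h} e + measure lborel {a..a+h} *\<^sub>R (\<eta> * (2 * M + N))) {a..a+h}"
        by (intro has_integral_add integrable_integral ie has_integral_const_real) (use a in auto)
      have cI: "c \<bullet> I \<le> integral {a..a+h} e + h * (\<eta> * (2 * M + N))"
        using has_integral_le[OF i1 i2 le] h by simp
      have "(norm (u (a + h)))\<^sup>2 = (norm c)\<^sup>2 + 2 * (c \<bullet> I) + (norm I)\<^sup>2"
        by (simp add: I_def power2_norm_eq_inner inner_diff_left inner_diff_right inner_commute)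
      also have "\<dots> \<le> (norm (u a))\<^sup>2 + 2 * (integral {a..a+h} e + h * (\<eta> * (2 * M + N))) + (M * h)\<^sup>2"
        using contraction[OF h(1), of "u a"] by (intro add_mono power_mono mult_left_mono cI nI) (auto simp: c_def)
      also have "(M * h)\<^sup>2 \<le> M\<^sup>2 * (h * \<eta>)"
        unfolding power_mult_distrib using h by (simp add: power2_eq_square mult_left_mono)
      finally show ?thesis by (simp add: C_def algebra_simps)
    qed
    obtain m where m: "m > 0" "m \<le> b" "m \<le> d" "m \<le> \<eta>"
      by (rule that[of "min (min b d) \<eta>"]) (use b d \<eta> in auto)
    obtain n where n: "\<tau> / m < real n" using reals_Archimedean2 by blast
    from m(1) have n0: "real n > 0" using n \<tau>0 by (meson divide_pos_pos less_trans)
    define h where "h = \<tau> / real n"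
    have h: "h > 0" "h < m" "real n * h = \<tau>"
      using n n0 \<tau>0 m(1) by (auto simp: h_def field_simps)
    have "(norm (u (real k * h)))\<^sup>2 \<le> (norm (u 0))\<^sup>2 + 2 * integral {0..real k * h} e + real k * h * C * \<eta>"
      if "k \<le> n" for k
      using that
    proof (induction k)
      case (Suc k)
      have le: "real k * h + h \<le> \<tau>"
      proof -
        have "real (Suc k) * h \<le> real n * h" using Suc.prems h by (intro mult_right_mono) auto
        then show ?thesis using h(3) by (simp add: algebra_simps)
      qed
      have kh: "0 \<le> real k * h" using h by simp
      have "(norm (u (real k * h + h)))\<^sup>2 \<le> (norm (u (real k * h)))\<^sup>2
          + 2 * integral {real k * h..real k * h + h} e + h * C * \<eta>"
        by (rule step) (use h m le kh in auto)
      moreover have "integral {0..real k * h} e + integral {real k * h..real k * h + h} e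
          = integral {0..real k * h + h} e"
        by (rule Henstock_Kurzweil_Integration.integral_combine) (use h le kh ie in auto)
      moreover have "real (Suc k) * h = real k * h + h" by (simp add: algebra_simps)
      ultimately show ?case using Suc by (simp add: algebra_simps)
    qed simp
    from this[of n] h(3) show ?thesis by simp
  qed
  show ?thesis
  proof (rule field_le_epsilon)
    fix \<epsilon> :: real assume \<epsilon>: "\<epsilon> > 0"
    show "(norm (u \<tau>))\<^sup>2 \<le> (norm (u 0))\<^sup>2 + 2 * integral {0..\<tau>} e + \<epsilon>"
      using approx[of "\<epsilon> / (\<tau> * C)"] \<epsilon> \<tau>0 C by simp
  qed
qed simp

end

section \<open>Existence of mild solutions for bounded perturbations\<close>

context contraction_semigroup
begin

lemma convolution_integrable:
  assumes g: "continuous_on {0..} g"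
  shows "(\<lambda>s. S (t - s) (g s)) integrable_on {0..t}"
  by (intro integrable_continuous_interval continuous_on_S continuous_intros continuous_on_subset[OF g]) auto

lemma continuous_on_convolution:
  assumes g: "continuous_on {0..} g"
  shows "continuous_on {0..} (\<lambda>t. integral {0..t} (\<lambda>s. S (t - s) (g s)))"
proof -
  \<comment> \<open>Rescaling to the unit interval moves the variable limit of integration into the integrand.\<close>
  have "continuous_on {0..} (\<lambda>t. t *\<^sub>R integral (cbox 0 1) (\<lambda>r. S (t - t * r) (g (t * r))))"
  proof (intro continuous_intros integral_continuous_on_param)
    have "t * r \<le> t" if "t \<ge> 0" "r \<le> 1" for t r :: real
      using mult_left_mono[OF that(2,1)] by simp
    then have "continuous_on ({0..} \<times> cbox 0 1) (\<lambda>p. S (fst p - fst p * snd p) (g (fst p * snd p)))"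
      by (intro continuous_on_S continuous_intros continuous_on_compose2[OF g]) (auto simp: cbox_interval)
    then show "continuous_on ({0..} \<times> cbox 0 1) (\<lambda>(t, r). S (t - t * r) (g (t * r)))"
      by (simp add: case_prod_beta)
  qed
  moreover have "t *\<^sub>R integral (cbox 0 1) (\<lambda>r. S (t - t * r) (g (t * r)))
      = integral {0..t} (\<lambda>s. S (t - s) (g s))" if t: "t \<ge> 0" for t
  proof (cases "t = 0")
    case False
    have "(\<lambda>x. x / t) ` {0..t} = {0..1}"
      using t False by (simp add: image_divide_atLeastAtMost)
    then show ?thesis
      using integral_stretch_real[OF False, of 0 t "\<lambda>s. S (t - s) (g s)"] t False
      by (simp add: cbox_interval)
  qed simp
  ultimately show ?thesis by (rule continuous_on_eq) simp
qed

lemma norm_convolution_le: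
  assumes g: "continuous_on {0..} g" and t: "t \<ge> 0" and l: "l > 0" and b: "b \<ge> 0"
    and le: "\<And>s. s \<ge> 0 \<Longrightarrow> norm (g s) \<le> b * exp (l * s)"
  shows "norm (integral {0..t} (\<lambda>s. S (t - s) (g s))) \<le> b / l * exp (l * t)"
proof -
  have "((\<lambda>s. b * exp (l * s)) has_integral (b / l * exp (l * t) - b / l * exp (l * 0))) {0..t}"
    by (rule fundamental_theorem_of_calculus[OF t])
       (use l in \<open>auto intro!: derivative_eq_intros simp: has_real_derivative_iff_has_vector_derivative[symmetric]\<close>)
  note * = this
  have "norm (integral {0..t} (\<lambda>s. S (t - s) (g s))) \<le> integral {0..t} (\<lambda>s. b * exp (l * s))"
  proof (rule integral_norm_bound_integral[OF convolution_integrable[OF g] has_integral_integrable[OF *]])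
    fix s assume "s \<in> {0..t}"
    then show "norm (S (t - s) (g s)) \<le> b * exp (l * s)"
      using contraction[of "t - s" "g s"] le[of s] by simp
  qed
  also have "\<dots> = b / l * exp (l * t) - b / l" using integral_unique[OF *] by simp
  also have "\<dots> \<le> b / l * exp (l * t)" using b l by simp
  finally show ?thesis .
qed

text \<open>Banach's fixed point theorem for \<open>\<phi>(t) = e\<^sup>-\<^sup>l\<^sup>t w(t)\<close> in the space of bounded continuous functions. The
  weight makes the integral operator a contraction with factor \<open>L / l = 1 / 2\<close> on the whole
  half-line. Functions are extended to negative times by their value at zero.\<close>

lemma mild_solution_exists:
  assumes P: "bounded_linear P"
  shows "\<exists>w. continuous_on {0..} w \<and>
    (\<forall>t\<ge>0. w t = S t x + integral {0..t} (\<lambda>s. S (t - s) (P (w s))))"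
proof -
  interpret P: bounded_linear P by fact
  obtain L where L: "L > 0" "\<And>y. norm (P y) \<le> norm y * L" using P.pos_bounded by blast
  define l where "l = 2 * L"
  have l: "l > 0" using L by (simp add: l_def)
  define g where "g \<phi> s = P (exp (l * s) *\<^sub>R apply_bcontfun \<phi> s)" for \<phi> :: "real \<Rightarrow>\<^sub>C 'a" and s
  have g: "continuous_on X (g \<phi>)" for \<phi> X
    unfolding g_def by (intro P.continuous_on continuous_intros) auto
  define F where "F \<phi> t = S t x + integral {0..t} (\<lambda>s. S (t - s) (g \<phi> s))" for \<phi> t
  have F: "continuous_on {0..} (F \<phi>)" for \<phi>
    unfolding F_def by (intro continuous_intros continuous_on_convolution g continuous_on_S) auto
  define \<Psi> where "\<Psi> \<phi> t = exp (- (l * max 0 t)) *\<^sub>R F \<phi> (max 0 t)" for \<phi> t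
  have "\<Psi> \<phi> \<in> bcontfun" for \<phi>
    unfolding bcontfun_def
  proof (intro CollectI conjI)
    show "continuous_on UNIV (\<Psi> \<phi>)"
      unfolding \<Psi>_def by (intro continuous_intros continuous_on_compose2[OF F]) auto
    obtain b where b: "b > 0" "\<And>s. norm (apply_bcontfun \<phi> s) \<le> b"
      using bounded_apply_bcontfun[of \<phi>] by (auto simp: bounded_pos)
    have "norm (\<Psi> \<phi> t) \<le> norm x + L * b / l" for t
    proof -
      let ?t = "max 0 t"
      have t: "?t \<ge> 0" by simp
      have "norm (integral {0..?t} (\<lambda>s. S (?t - s) (g \<phi> s))) \<le> (L * b) / l * exp (l * ?t)"
      proof (rule norm_convolution_le[OF g t l])
        fix s
        have "norm (g \<phi> s) \<le> (exp (l * s) * norm (apply_bcontfun \<phi> s)) * L"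
          unfolding g_def using L(2)[of "exp (l * s) *\<^sub>R apply_bcontfun \<phi> s"] by simp
        also have "\<dots> \<le> (exp (l * s) * b) * L" using b L by (intro mult_right_mono mult_left_mono) auto
        finally show "norm (g \<phi> s) \<le> L * b * exp (l * s)" by (simp add: algebra_simps)
      qed (use L b in auto)
      then have "norm (F \<phi> ?t) \<le> norm x + (L * b) / l * exp (l * ?t)"
        unfolding F_def by (intro norm_triangle_mono contraction t)
      then have "norm (\<Psi> \<phi> t) \<le> exp (- (l * ?t)) * (norm x + (L * b) / l * exp (l * ?t))"
        unfolding \<Psi>_def by (simp add: mult_left_mono)
      also have "\<dots> = exp (- (l * ?t)) * norm x + L * b / l * (exp (- (l * ?t)) * exp (l * ?t))"
        by (simp only: algebra_simps)
      also have "\<dots> = exp (- (l * ?t)) * norm x + L * b / l"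
        by (simp flip: exp_add)
      also have "exp (- (l * ?t)) * norm x \<le> 1 * norm x"
        using l by (intro mult_right_mono) auto
      finally show ?thesis by simp
    qed
    then show "bounded (range (\<Psi> \<phi>))" unfolding bounded_iff by blast
  qed
  then have app: "apply_bcontfun (Bcontfun (\<Psi> \<phi>)) = \<Psi> \<phi>" for \<phi>
    by (rule Bcontfun_inverse)
  have lip: "dist (Bcontfun (\<Psi> \<phi>)) (Bcontfun (\<Psi> \<psi>)) \<le> (1/2) * dist \<phi> \<psi>" for \<phi> \<psi>
  proof (rule dist_bound)
    fix t :: real
    let ?t = "max 0 t" and ?g = "\<lambda>s. g \<phi> s - g \<psi> s"
    have t: "?t \<ge> 0" by simp
    have "integral {0..?t} (\<lambda>s. S (?t - s) (?g s)) = integral {0..?t} (\<lambda>s. S (?t - s) (g \<phi> s) - S (?t - s) (g \<psi> s))"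
      by (rule integral_cong) (simp add: S_diff)
    also have "\<dots> = integral {0..?t} (\<lambda>s. S (?t - s) (g \<phi> s)) - integral {0..?t} (\<lambda>s. S (?t - s) (g \<psi> s))"
      by (intro Henstock_Kurzweil_Integration.integral_diff convolution_integrable g)
    also have "\<dots> = F \<phi> ?t - F \<psi> ?t" by (simp add: F_def)
    finally have eq: "F \<phi> ?t - F \<psi> ?t = integral {0..?t} (\<lambda>s. S (?t - s) (?g s))" by simp
    have "norm (F \<phi> ?t - F \<psi> ?t) \<le> (L * dist \<phi> \<psi>) / l * exp (l * ?t)"
      unfolding eq
    proof (rule norm_convolution_le[OF continuous_on_diff[OF g g] t l])
      fix s
      have "?g s = P (exp (l * s) *\<^sub>R (apply_bcontfun \<phi> s - apply_bcontfun \<psi> s))"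
        by (simp add: g_def P.diff scaleR_diff_right)
      then have "norm (?g s) \<le> (exp (l * s) * dist (apply_bcontfun \<phi> s) (apply_bcontfun \<psi> s)) * L"
        using L(2)[of "exp (l * s) *\<^sub>R (apply_bcontfun \<phi> s - apply_bcontfun \<psi> s)"] by (simp add: dist_norm)
      also have "\<dots> \<le> (exp (l * s) * dist \<phi> \<psi>) * L"
        using L dist_bounded by (intro mult_right_mono mult_left_mono) auto
      finally show "norm (?g s) \<le> L * dist \<phi> \<psi> * exp (l * s)" by (simp add: algebra_simps)
    qed (use L in auto)
    then have "exp (- (l * ?t)) * norm (F \<phi> ?t - F \<psi> ?t) \<le> exp (- (l * ?t)) * ((1/2) * dist \<phi> \<psi> * exp (l * ?t))"
      using L by (intro mult_left_mono) (auto simp: l_def)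
    also have "\<dots> = (1/2) * dist \<phi> \<psi> * (exp (- (l * ?t)) * exp (l * ?t))" by (simp only: algebra_simps)
    also have "\<dots> = (1/2) * dist \<phi> \<psi>" by (simp flip: exp_add)
    finally have fin: "exp (- (l * ?t)) * norm (F \<phi> ?t - F \<psi> ?t) \<le> (1/2) * dist \<phi> \<psi>" .
    have "dist (\<Psi> \<phi> t) (\<Psi> \<psi> t) = exp (- (l * ?t)) * norm (F \<phi> ?t - F \<psi> ?t)"
      by (simp add: \<Psi>_def dist_norm flip: scaleR_diff_right)
    then show "dist (apply_bcontfun (Bcontfun (\<Psi> \<phi>)) t) (apply_bcontfun (Bcontfun (\<Psi> \<psi>)) t) \<le> (1/2) * dist \<phi> \<psi>"
      unfolding app using fin by simp
  qed
  have "\<exists>!\<phi>. Bcontfun (\<Psi> \<phi>) = \<phi>"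
    by (rule banach_fix_type[of "1/2"]) (use lip in auto)
  then obtain \<phi> where "Bcontfun (\<Psi> \<phi>) = \<phi>" by blast
  then have \<phi>: "apply_bcontfun \<phi> = \<Psi> \<phi>" using app[of \<phi>] by simp
  define w where "w t = exp (l * t) *\<^sub>R apply_bcontfun \<phi> t" for t
  have w: "w t = F \<phi> t" if "t \<ge> 0" for t
    using that unfolding w_def \<phi> \<Psi>_def by (simp flip: exp_add)
  have "w t = S t x + integral {0..t} (\<lambda>s. S (t - s) (P (w s)))" if "t \<ge> 0" for t
    unfolding w[OF that] by (simp add: F_def g_def w_def)
  moreover have "continuous_on {0..} w" unfolding w_def by (intro continuous_intros) auto
  ultimately show ?thesis by blast
qed

end

section \<open>Exponential decay under time-varying damping\<close>

context contraction_semigroup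
begin

context
  fixes B :: "'u::{real_inner, banach} \<Rightarrow> 'a"
  assumes B: "bounded_linear B"
begin

lemma bounded_linear_B_adjoint: "bounded_linear (\<lambda>x. B (adjoint B x))"
  by (rule bounded_linear_compose[OF B bounded_linear_adjoint[OF B]])

lemma inner_B_adjoint: "B (adjoint B x) \<bullet> y = adjoint B x \<bullet> adjoint B y"
  by (rule inner_adjoint[OF B])

lemma B_adjoint_continuous:
  "continuous_on X u \<Longrightarrow> continuous_on X (\<lambda>s. B (adjoint B (u s)))"
  "continuous_on X u \<Longrightarrow> continuous_on X (\<lambda>s. adjoint B (u s))"
  using bounded_linear.continuous_on[OF bounded_linear_B_adjoint]
    bounded_linear.continuous_on[OF bounded_linear_adjoint[OF B]] by auto

text \<open>The forcing \<open>-d(s) P v(s)\<close> stays in a compact set, the image of \<open>[d\<^sub>0, d\<^sub>1] \<times> [0, \<tau>]\<close>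
  under \<open>(c, s) \<mapsto> -c P v(s)\<close>, no matter how \<open>d\<close> varies.\<close>

lemma damped_energy_inequality:
  assumes v: "mild_on \<tau> (\<lambda>s. - (d s *\<^sub>R B (adjoint B (v s)))) v" and \<tau>: "\<tau> \<ge> 0"
    and d: "\<And>s. s \<in> {0..\<tau>} \<Longrightarrow> d0 \<le> d s \<and> d s \<le> d1"
  shows "(norm (v \<tau>))\<^sup>2 \<le> (norm (v 0))\<^sup>2 - 2 * d0 * integral {0..\<tau>} (\<lambda>s. (norm (adjoint B (v s)))\<^sup>2)"
proof -
  have cv: "continuous_on {0..\<tau>} v" using v by (simp add: mild_on_def)
  let ?F = "\<lambda>p. - (fst p *\<^sub>R B (adjoint B (v (snd p))))"
  let ?K = "?F ` ({d0..d1} \<times> {0..\<tau>})"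
  have "(norm (v \<tau>))\<^sup>2 \<le> (norm (v 0))\<^sup>2 + 2 * integral {0..\<tau>} (\<lambda>s. - d0 * (norm (adjoint B (v s)))\<^sup>2)"
  proof (rule energy_inequality[OF v \<tau>, of ?K])
    show "compact ?K"
      by (intro compact_continuous_image compact_Times continuous_intros B_adjoint_continuous
          continuous_on_compose2[OF cv]) auto
    show "- (d s *\<^sub>R B (adjoint B (v s))) \<in> ?K" if "s \<in> {0..\<tau>}" for s
      using d[OF that] that by (intro image_eqI[of _ _ "(d s, s)"]) auto
    show "continuous_on {0..\<tau>} (\<lambda>s. - d0 * (norm (adjoint B (v s)))\<^sup>2)"
      by (intro continuous_intros B_adjoint_continuous cv)
    show "- (d s *\<^sub>R B (adjoint B (v s))) \<bullet> v s \<le> - d0 * (norm (adjoint B (v s)))\<^sup>2"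
      if "s \<in> {0..\<tau>}" for s
      using d[OF that] by (simp add: inner_B_adjoint power2_norm_eq_inner mult_right_mono)
  qed
  also have "integral {0..\<tau>} (\<lambda>s. - d0 * (norm (adjoint B (v s)))\<^sup>2)
      = - d0 * integral {0..\<tau>} (\<lambda>s. (norm (adjoint B (v s)))\<^sup>2)"
    by (rule integral_mult_right)
  finally show ?thesis by simp
qed

lemma difference_energy_inequality:
  assumes v: "mild_on \<tau> (\<lambda>s. - (d s *\<^sub>R B (adjoint B (v s)))) v"
    and w: "mild_on \<tau> (\<lambda>s. - (d0 *\<^sub>R B (adjoint B (w s)))) w"
    and vw: "v 0 = w 0" and \<tau>: "\<tau> \<ge> 0" and d0: "d0 > 0"
    and d: "\<And>s. s \<in> {0..\<tau>} \<Longrightarrow> d0 \<le> d s \<and> d s \<le> d1"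
  shows "(norm (v \<tau> - w \<tau>))\<^sup>2 \<le>
    (d1 - d0)\<^sup>2 / (2 * d0) * integral {0..\<tau>} (\<lambda>s. (norm (adjoint B (v s)))\<^sup>2)"
proof -
  have cv: "continuous_on {0..\<tau>} v" "continuous_on {0..\<tau>} w" using v w by (auto simp: mild_on_def)
  let ?F = "\<lambda>p. - (fst p *\<^sub>R B (adjoint B (v (snd p)))) - - (d0 *\<^sub>R B (adjoint B (w (snd p))))"
  let ?K = "?F ` ({d0..d1} \<times> {0..\<tau>})"
  let ?k = "(d1 - d0)\<^sup>2 / (4 * d0)"
  interpret Bs: bounded_linear "adjoint B" by (rule bounded_linear_adjoint[OF B])
  have "(norm (v \<tau> - w \<tau>))\<^sup>2 \<le> (norm (v 0 - w 0))\<^sup>2 + 2 * integral {0..\<tau>} (\<lambda>s. ?k * (norm (adjoint B (v s)))\<^sup>2)"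
  proof (rule energy_inequality[OF mild_on_diff[OF v w] \<tau>, of ?K])
    show "compact ?K"
      by (intro compact_continuous_image compact_Times continuous_intros B_adjoint_continuous
          continuous_on_compose2[OF cv(1)] continuous_on_compose2[OF cv(2)]) auto
    show "- (d s *\<^sub>R B (adjoint B (v s))) - - (d0 *\<^sub>R B (adjoint B (w s))) \<in> ?K" if "s \<in> {0..\<tau>}" for s
      using d[OF that] that by (intro image_eqI[of _ _ "(d s, s)"]) auto
    show "continuous_on {0..\<tau>} (\<lambda>s. ?k * (norm (adjoint B (v s)))\<^sup>2)"
      by (intro continuous_intros B_adjoint_continuous cv)
    fix s assume s: "s \<in> {0..\<tau>}"
    define p where "p = adjoint B (v s)"
    define q where "q = adjoint B (v s - w s)"
    have pq: "adjoint B (w s) = p - q" by (simp add: p_def q_def Bs.diff)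
    define c where "c = d s - d0"
    have c: "0 \<le> c" "c \<le> d1 - d0" using d[OF s] by (auto simp: c_def)
    have "(- (d s *\<^sub>R B (adjoint B (v s))) - - (d0 *\<^sub>R B (adjoint B (w s)))) \<bullet> (v s - w s)
        = - (d s * (p \<bullet> q)) + d0 * ((p - q) \<bullet> q)"
      unfolding inner_diff_left inner_minus_left inner_scaleR_left inner_B_adjoint
      by (simp add: inner_diff_left pq flip: p_def q_def)
    also have "\<dots> = - (c * (p \<bullet> q)) - d0 * (norm q)\<^sup>2"
      by (simp add: c_def inner_diff_left power2_norm_eq_inner algebra_simps)
    also have "- (c * (p \<bullet> q)) \<le> c * (norm p * norm q)"
    proof -
      have "- (p \<bullet> q) \<le> norm p * norm q" using norm_cauchy_schwarz[of "- p" q] by simp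
      then show ?thesis using mult_left_mono[OF _ c(1)] by fastforce
    qed
    also have "c * (norm p * norm q) - d0 * (norm q)\<^sup>2 \<le> c\<^sup>2 / (4 * d0) * (norm p)\<^sup>2"
    proof -
      \<comment> \<open>Young's inequality, by completing the square.\<close>
      have "c\<^sup>2 / (4 * d0) * (norm p)\<^sup>2 - (c * (norm p * norm q) - d0 * (norm q)\<^sup>2)
          = (c * norm p - 2 * d0 * norm q)\<^sup>2 / (4 * d0)"
        using d0 by (simp add: power2_eq_square field_simps)
      moreover have "\<dots> \<ge> 0" using d0 by simp
      ultimately show ?thesis by linarith
    qed
    also have "\<dots> \<le> ?k * (norm p)\<^sup>2"
      using c d0 by (intro mult_right_mono divide_right_mono power_mono) auto
    finally show "(- (d s *\<^sub>R B (adjoint B (v s))) - - (d0 *\<^sub>R B (adjoint B (w s)))) \<bullet> (v s - w s)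
        \<le> ?k * (norm (adjoint B (v s)))\<^sup>2" by (simp add: p_def)
  qed
  also have "integral {0..\<tau>} (\<lambda>s. ?k * (norm (adjoint B (v s)))\<^sup>2)
      = ?k * integral {0..\<tau>} (\<lambda>s. (norm (adjoint B (v s)))\<^sup>2)"
    by (rule integral_mult_right)
  finally show ?thesis using vw by simp
qed

lemma contraction_over_window:
  assumes v: "mild_on \<tau> (\<lambda>s. - (d s *\<^sub>R B (adjoint B (v s)))) v"
    and w: "mild_on \<tau> (\<lambda>s. - (d0 *\<^sub>R B (adjoint B (w s)))) w"
    and vw: "v 0 = w 0" and \<tau>: "\<tau> \<ge> 0" and d0: "d0 > 0"
    and d: "\<And>s. s \<in> {0..\<tau>} \<Longrightarrow> d0 \<le> d s \<and> d s \<le> d1"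
    and half: "norm (w \<tau>) \<le> 1 / 2 * norm (v 0)"
    and \<kappa>: "\<kappa> = (d1 - d0)\<^sup>2 / (2 * d0\<^sup>2)"
  shows "(norm (v \<tau>))\<^sup>2 \<le> (1 / 2 + \<kappa>) / (1 + \<kappa>) * (norm (v 0))\<^sup>2"
proof -
  define E where "E = integral {0..\<tau>} (\<lambda>s. (norm (adjoint B (v s)))\<^sup>2)"
  have 1: "2 * d0 * E \<le> (norm (v 0))\<^sup>2 - (norm (v \<tau>))\<^sup>2"
    using damped_energy_inequality[OF v \<tau> d] by (simp add: E_def)
  have 2: "(norm (v \<tau> - w \<tau>))\<^sup>2 \<le> (d1 - d0)\<^sup>2 / (2 * d0) * E"
    using difference_energy_inequality[OF v w vw \<tau> d0 d] by (simp add: E_def)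
  have 3: "(norm (w \<tau>))\<^sup>2 \<le> 1 / 4 * (norm (v 0))\<^sup>2"
    using power_mono[OF half, of 2] by (simp add: power_mult_distrib power2_eq_square)
  have \<kappa>0: "\<kappa> \<ge> 0" by (simp add: \<kappa>)
  have "(norm (v \<tau>))\<^sup>2 \<le> 2 * (norm (w \<tau>))\<^sup>2 + 2 * (norm (v \<tau> - w \<tau>))\<^sup>2"
  proof -
    have "norm (v \<tau>) \<le> norm (w \<tau>) + norm (v \<tau> - w \<tau>)" by (metis norm_triangle_sub)
    then have "(norm (v \<tau>))\<^sup>2 \<le> (norm (w \<tau>) + norm (v \<tau> - w \<tau>))\<^sup>2" by (intro power_mono) auto
    also have "\<dots> \<le> 2 * (norm (w \<tau>))\<^sup>2 + 2 * (norm (v \<tau> - w \<tau>))\<^sup>2"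
      using sum_squares_bound[of "norm (w \<tau>)" "norm (v \<tau> - w \<tau>)"] by (simp add: power2_sum)
    finally show ?thesis .
  qed
  also have "\<dots> \<le> 1 / 2 * (norm (v 0))\<^sup>2 + \<kappa> * (2 * d0 * E)"
  proof -
    have "\<kappa> * (2 * d0 * E) = 2 * ((d1 - d0)\<^sup>2 / (2 * d0) * E)"
      using d0 by (simp add: \<kappa> power2_eq_square[of d0])
    then show ?thesis using 2 3 by linarith
  qed
  also have "\<dots> \<le> 1 / 2 * (norm (v 0))\<^sup>2 + \<kappa> * ((norm (v 0))\<^sup>2 - (norm (v \<tau>))\<^sup>2)"
    using 1 \<kappa>0 by (intro add_left_mono mult_left_mono)
  finally have "(1 + \<kappa>) * (norm (v \<tau>))\<^sup>2 \<le> (1 / 2 + \<kappa>) * (norm (v 0))\<^sup>2"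
    by (simp add: algebra_simps)
  then show ?thesis using \<kappa>0 by (simp add: field_simps)
qed

end

end

text \<open>The factor \<open>1 / Q\<close> accounts for the incomplete last window.\<close>

lemma exponential_decay_of_window_contraction:
  fixes N :: "real \<Rightarrow> real"
  assumes \<tau>: "\<tau> > 0" and Q: "0 < Q" "Q < 1"
    and mono: "\<And>s t. 0 \<le> s \<Longrightarrow> s \<le> t \<Longrightarrow> N t \<le> N s"
    and step: "\<And>t. t \<ge> 0 \<Longrightarrow> N (t + \<tau>) \<le> Q * N t"
    and N0: "N 0 \<ge> 0" and t: "t \<ge> 0"
  shows "N t \<le> (1 / Q) * exp (- (- ln Q / \<tau>) * t) * N 0"
proof -
  have pow: "N (real k * \<tau>) \<le> Q ^ k * N 0" for k
  proof (induction k)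
    case (Suc k)
    have "N (real (Suc k) * \<tau>) = N (real k * \<tau> + \<tau>)" by (simp add: algebra_simps)
    also have "\<dots> \<le> Q * N (real k * \<tau>)" using \<tau> by (intro step) simp
    also have "\<dots> \<le> Q * (Q ^ k * N 0)" using Q Suc by (intro mult_left_mono) auto
    finally show ?case by simp
  qed simp
  define k where "k = nat \<lfloor>t / \<tau>\<rfloor>"
  have k: "real k \<le> t / \<tau>" "t / \<tau> < real k + 1"
    using \<tau> t unfolding k_def by (simp_all add: of_nat_nat) 
  have "N t \<le> N (real k * \<tau>)" using k \<tau> by (intro mono) (auto simp: field_simps)
  also note pow
  also have "Q ^ k \<le> (1 / Q) * exp (- (- ln Q / \<tau>) * t)"
  proof -
    have "Q ^ Suc k = exp (real (Suc k) * ln Q)"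
      using Q by (metis exp_ln exp_of_nat_mult)
    also have "real (Suc k) * ln Q \<le> (t / \<tau>) * ln Q"
      using k(2) Q by (intro mult_right_mono_neg) auto
    finally have "Q * Q ^ k \<le> exp (- (- ln Q / \<tau>) * t)" by (simp add: mult.commute)
    then show ?thesis using Q by (simp add: field_simps)
  qed
  finally show ?thesis using N0 by (simp add: mult_right_mono)
qed

theorem theorem4:
  fixes D :: "'h::{real_inner, banach} set"
    and A :: "'h \<Rightarrow> 'h"
    and B :: "'u::{real_inner, banach} \<Rightarrow> 'h"
    and d :: "real \<Rightarrow> real"
    and d0 d1 :: real
  assumes "linear_operator_on D A"
    and "densely_defined D"
    and "closed_operator D A"
    and "dissipative D A"
    and "dissipative (adjoint_domain D A) (adjoint_op D A)"
    and "bounded_linear B"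
    and "restricts_to_bounded_on_domain D A (\<lambda>x. B (adjoint B x))"
    and "d \<in> borel_measurable (lebesgue_on {0..})"
    and "\<exists>M. AE t in lebesgue_on {0..}. \<bar>d t\<bar> \<le> M"
    and "d0 > 0" and "d1 > 0"
    and "AE t in lebesgue_on {0..}. d0 \<le> d t \<and> d t \<le> d1"
    and "globally_exponentially_stable D A B (\<lambda>_. d0)"
  shows "\<exists>K>0. \<exists>\<beta>>0. \<forall>v0 v. mild_solution D A B d v0 v \<longrightarrow>
           (\<forall>t\<ge>0. norm (v t) \<le> K * exp (- \<beta> * t) * norm v0)"
proof -
  define S where "S = semigroup_of D A"
  interpret contraction_semigroup S
    unfolding S_def by (intro max_dissipative_semigroup_of max_dissipative_of_adjoint assms)
  note B = \<open>bounded_linear B\<close> and d0 = \<open>d0 > 0\<close>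
  let ?P = "\<lambda>x. B (adjoint B x)"
  have mild: "(\<forall>\<tau>. mild_on \<tau> (\<lambda>s. - (c s *\<^sub>R ?P (v s))) v) \<and> v 0 = v0"
    if "mild_solution D A B c v0 v" for c v0 v
  proof -
    have v: "continuous_on {0..} v"
      "\<And>t. t \<ge> 0 \<Longrightarrow> (\<lambda>s. S (t - s) (c s *\<^sub>R ?P (v s))) integrable_on {0..t}"
      "\<And>t. t \<ge> 0 \<Longrightarrow> v t = S t v0 - integral {0..t} (\<lambda>s. S (t - s) (c s *\<^sub>R ?P (v s)))"
      using that by (auto simp: mild_solution_def S_def)
    have v0: "v 0 = v0" using v(3)[of 0] by (simp add: S_zero)
    have "mild_on \<tau> (\<lambda>s. - (c s *\<^sub>R ?P (v s))) v" for \<tau>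
      unfolding mild_on_def
    proof (intro conjI ballI)
      show "continuous_on {0..\<tau>} v" by (rule continuous_on_subset[OF v(1)]) auto
      fix t assume t: "t \<in> {0..\<tau>}"
      have "((\<lambda>s. - S (t - s) (c s *\<^sub>R ?P (v s))) has_integral (v t - S t v0)) {0..t}"
        using has_integral_neg[OF integrable_integral[OF v(2)[of t]]] t v(3)[of t] by simp
      then show "((\<lambda>s. S (t - s) (- (c s *\<^sub>R ?P (v s)))) has_integral (v t - S t (v 0))) {0..t}"
        unfolding v0
        by (rule has_integral_eq[rotated])
           (simp add: linear_neg[OF bounded_linear.linear[OF linear_S]])
    qed
    with v0 show ?thesis by blast
  qed
  have ex: "\<exists>w. mild_solution D A B (\<lambda>_. d0) x w" for x
  proof -
    have P: "bounded_linear (\<lambda>x. - (d0 *\<^sub>R ?P x))"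
      by (intro bounded_linear_minus bounded_linear_const_scaleR bounded_linear_B_adjoint[OF B])
    obtain w where w: "continuous_on {0..} w"
      "\<And>t. t \<ge> 0 \<Longrightarrow> w t = S t x + integral {0..t} (\<lambda>s. S (t - s) (- (d0 *\<^sub>R ?P (w s))))"
      using mild_solution_exists[OF P, of x] by blast
    have "w t = S t x - integral {0..t} (\<lambda>s. S (t - s) (d0 *\<^sub>R ?P (w s)))" if t: "t \<ge> 0" for t
    proof -
      have "integral {0..t} (\<lambda>s. S (t - s) (- (d0 *\<^sub>R ?P (w s))))
          = integral {0..t} (\<lambda>s. - S (t - s) (d0 *\<^sub>R ?P (w s)))"
        by (rule integral_cong) (simp add: linear_neg[OF bounded_linear.linear[OF linear_S]])
      then show ?thesis using w(2)[OF t] by simp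
    qed
    moreover have "(\<lambda>s. S (t - s) (d0 *\<^sub>R ?P (w s))) integrable_on {0..t}" for t
      by (intro convolution_integrable continuous_intros B_adjoint_continuous[OF B] w)
    ultimately show ?thesis using w(1) unfolding mild_solution_def S_def by blast
  qed
  obtain C0 \<alpha> where C0: "C0 > 0" and \<alpha>: "\<alpha> > 0"
    and stable: "\<And>x w t. mild_solution D A B (\<lambda>_. d0) x w \<Longrightarrow> t \<ge> 0 \<Longrightarrow>
      norm (w t) \<le> C0 * exp (- \<alpha> * t) * norm x"
    using assms(13) unfolding globally_exponentially_stable_def by blast
  \<comment> \<open>A window after which the reference system has halved the norm.\<close>
  define \<tau> where "\<tau> = max 1 (ln (2 * C0) / \<alpha>)"
  have \<tau>: "\<tau> > 0" by (simp add: \<tau>_def)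
  have half: "C0 * exp (- \<alpha> * \<tau>) \<le> 1 / 2"
  proof -
    have "ln (2 * C0) \<le> \<alpha> * \<tau>" using \<alpha> by (simp add: \<tau>_def max_def field_simps)
    then have "2 * C0 \<le> exp (\<alpha> * \<tau>)" using C0 by (metis exp_le_cancel_iff exp_ln mult_pos_pos zero_less_numeral)
    then show ?thesis by (simp add: exp_minus field_simps)
  qed
  \<comment> \<open>Changing \<open>d\<close> on a null set, its bounds hold at every time; \<open>d2\<close> spares the proof of \<open>d0 \<le> d1\<close>.\<close>
  define d' where "d' t = (if d0 \<le> d t \<and> d t \<le> d1 then d t else d0)" for t
  define d2 where "d2 = max d0 d1"
  have d': "d0 \<le> d' t \<and> d' t \<le> d2" for t by (auto simp: d'_def d2_def)
  obtain Z where Z: "negligible Z" "\<And>t. t \<ge> 0 \<Longrightarrow> t \<notin> Z \<Longrightarrow> d' t = d t"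
  proof -
    have "AE t in lebesgue. t \<in> {0..} \<longrightarrow> d0 \<le> d t \<and> d t \<le> d1"
      by (rule iffD1[OF AE_restrict_space_iff assms(12)]) simp
    then obtain Z where "Z \<in> null_sets lebesgue" "{t. \<not> (t \<in> {0..} \<longrightarrow> d0 \<le> d t \<and> d t \<le> d1)} \<subseteq> Z"
      unfolding eventually_ae_filter by auto
    then show thesis by (intro that[of Z]) (auto simp: negligible_iff_null_sets d'_def)
  qed
  define \<kappa> where "\<kappa> = (d2 - d0)\<^sup>2 / (2 * d0\<^sup>2)"
  define Q where "Q = sqrt ((1 / 2 + \<kappa>) / (1 + \<kappa>))"
  have \<kappa>: "\<kappa> \<ge> 0" by (simp add: \<kappa>_def)
  have Q: "0 < Q" "Q < 1" using \<kappa> by (simp_all add: Q_def)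
  have main: "norm (v t) \<le> (1 / Q) * exp (- (- ln Q / \<tau>) * t) * norm v0"
    if v: "mild_solution D A B d v0 v" and t: "t \<ge> 0" for v0 v t
  proof -
    have v0: "v 0 = v0" using mild[OF v] by blast
    have v': "mild_on \<sigma> (\<lambda>s. - (d' s *\<^sub>R ?P (v s))) v" for \<sigma>
      unfolding mild_on_def
    proof (intro conjI ballI)
      have m: "mild_on \<sigma> (\<lambda>s. - (d s *\<^sub>R ?P (v s))) v" using mild[OF v] by blast
      then show "continuous_on {0..\<sigma>} v" by (simp add: mild_on_def)
      fix t assume t: "t \<in> {0..\<sigma>}"
      with m have "((\<lambda>s. S (t - s) (- (d s *\<^sub>R ?P (v s)))) has_integral (v t - S t (v 0))) {0..t}"
        by (simp add: mild_on_def)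
      then show "((\<lambda>s. S (t - s) (- (d' s *\<^sub>R ?P (v s)))) has_integral (v t - S t (v 0))) {0..t}"
        by (rule has_integral_spike[OF Z(1), rotated]) (simp add: Z(2))
    qed
    have shift: "mild_on \<sigma> (\<lambda>s. - (d' (a + s) *\<^sub>R ?P (v (a + s)))) (\<lambda>s. v (a + s))" if "a \<ge> 0" for a \<sigma>
      using mild_on_shift[OF v' that, of \<sigma> "a + \<sigma>"] by simp
    have mono: "norm (v t) \<le> norm (v s)" if "0 \<le> s" "s \<le> t" for s t
    proof -
      have "(norm (v (s + (t - s))))\<^sup>2 \<le> (norm (v (s + 0)))\<^sup>2
          - 2 * d0 * integral {0..t - s} (\<lambda>r. (norm (adjoint B (v (s + r))))\<^sup>2)"
        by (rule damped_energy_inequality[OF B shift]) (use that d' in auto)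
      also have "\<dots> \<le> (norm (v s))\<^sup>2"
      proof -
        have "continuous_on {0..t - s} (\<lambda>r. v (s + r))"
          using shift[OF that(1), of "t - s"] by (simp add: mild_on_def)
        then have "(\<lambda>r. (norm (adjoint B (v (s + r))))\<^sup>2) integrable_on {0..t - s}"
          by (intro integrable_continuous_interval continuous_intros B_adjoint_continuous[OF B])
        then have "integral {0..t - s} (\<lambda>r. (norm (adjoint B (v (s + r))))\<^sup>2) \<ge> 0"
          by (rule Henstock_Kurzweil_Integration.integral_nonneg) simp
        then show ?thesis using d0 by simp
      qed
      finally have "(norm (v t))\<^sup>2 \<le> (norm (v s))\<^sup>2" by simp
      then show ?thesis by (rule power2_le_imp_le) simp
    qed
    have step: "norm (v (a + \<tau>)) \<le> Q * norm (v a)" if a: "a \<ge> 0" for a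
    proof -
      obtain w where w: "mild_solution D A B (\<lambda>_. d0) (v a) w" using ex by blast
      note w' = mild[OF w]
      have "norm (w \<tau>) \<le> C0 * exp (- \<alpha> * \<tau>) * norm (v a)" using stable[OF w] \<tau> by simp
      also have "\<dots> \<le> 1 / 2 * norm (v a)" by (rule mult_right_mono[OF half]) simp
      finally have "norm (w \<tau>) \<le> 1 / 2 * norm (v (a + 0))" by simp
      then have "(norm (v (a + \<tau>)))\<^sup>2 \<le> (1 / 2 + \<kappa>) / (1 + \<kappa>) * (norm (v (a + 0)))\<^sup>2"
        using contraction_over_window[OF B shift[OF a], of \<tau> d0 w d2 \<kappa>] w' \<tau> d0 d' \<kappa>_def by simp
      then have "sqrt ((norm (v (a + \<tau>)))\<^sup>2) \<le> sqrt ((1 / 2 + \<kappa>) / (1 + \<kappa>) * (norm (v a))\<^sup>2)"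
        by (simp only: real_sqrt_le_iff add_0_right)
      then show ?thesis
        unfolding Q_def real_sqrt_mult real_sqrt_abs abs_norm_cancel .
    qed
    show ?thesis
      using exponential_decay_of_window_contraction[of \<tau> Q "\<lambda>t. norm (v t)" t] \<tau> Q mono step t v0 by simp
  qed
  have "- ln Q / \<tau> > 0" "1 / Q > 0" using Q \<tau> by (simp_all add: divide_neg_pos)
  with main show ?thesis by blast
qed

end
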